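(* Let $(K,d)$, with partition $\{K_w\}_{w\in T}$ and measure $\mu$, satisfy the standing assumption (A) of the context, and suppose $p>\dim_{AR}(K,d)$. Then $K$ is $p$-conductively homogeneous if and only if for every $k\ge1$ there exists $c(k)>0$ such that $$\mathcal E_{M_*,p,m}\le c(k)\,\mathcal E_{p,m}(\{u\},\{v\},S^k(w))$$ for all $m\ge1$, $w\in T$ and $u,v\in S^k(w)$ with $u\ne v$.
   Context: Rooted tree. $T$ is a countably infinite set, $(T,\mathcal A)$ is a locally finite tree in which every vertex has at least two neighbours, $\phi\in T$ is the root. $|w|$ is the graph distance from $w$ to $\phi$, $T_n=\{w:|w|=n\}$, $\pi(w)$ is the parent of $w$ ($\pi(\phi)=\phi$), $S(w)$ is the set of children, $S^0(w)=\{w\}$, $S^{k+1}(w)=\bigcup_{v\in S(w)}S^k(v)$, $S^k(A)=\bigcup_{w\in A}S^k(w)$. Partition. A partition of a compact metrizable space $K$ without isolated points is a family $\{K_w\}_{w\in T}$ of non-empty compact subsets without isolated points such that $K_\phi=K$, $K_w=\bigcup_{v\in S(w)}K_v$, and for every sequence $(w(i))_{i\ge0}$ with $w(i)\in T_i$, $\pi(w(i+1))=w(i)$, the set $\bigcap_i K_{w(i)}$ is a single point. For $A\subseteq T_n$, $w\in A$, $M\ge0$, $\Gamma^A_M(w)$ is the set of $u\in A$ for which there are $u(0)=w,u(1),\dots,u(M)=u$ in $A$ with $K_{u(i)}\cap K_{u(i+1)}\neq\emptyset$ for all $i$; $\Gamma_M(w)=\Gamma_M^{T_n}(w)$. The partition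 is minimal if $K_w\setminus\bigcup_{v\in T_{|w|},v\ne w}K_v\neq\emptyset$ for all $w$, and uniformly finite if $\sup_w\#\Gamma_1(w)<\infty$. $E_n^*=\{(w,v)\in T_n\times T_n: w\ne v,\ K_w\cap K_v\ne\emptyset\}$. Standing assumption (A). $(K,d)$ is a compact connected metric space of diameter $1$ and $\{K_w\}_{w\in T}$ is a minimal, uniformly finite partition of $K$ such that: (1) every $K_w$ is connected. (2) There are $M_*\ge1$ and $r\in(0,1)$ with: (2A) $c_1r^{|w|}\le\mathrm{diam}(K_w,d)\le c_2r^{|w|}$ for all $w$, for some $c_1,c_2>0$; (2B) with $U_M(x:n)=\bigcup_{w\in T_n,x\in K_w}\bigcup_{v\in\Gamma_M(w)}K_v$, there are $c_1,c_2>0$ with $B_d(x,c_1r^n)\subseteq U_{M_*}(x:n)\subseteq B_d(x,c_2r^n)$ for all $x\in K,n\ge1$; (2C) there is $c>0$ such that for all $n\ge 1$, $w\in T_n$ there is $x\in K_w$ with $B_d(x,cr^n)\subseteq K_w$. (3) $\mu$ is a Borel regular probability measure on $K$ with the volume doubling property with respect to $d$, $\mu(K_w)=\sum_{v\in S(w)}\mu(K_v)$ for all $w$, and $\mu$ is exponential: there are $\gamma,\gamma_1\in(0,1)$, $m_1\ge1$ with $\mu(K_w)\ge\gamma\mu(K_{\pi(w)})$ and $\mu(K_v)\le\gamma_1\mu(K_w)$ for all $w\in T$, $v\in S^{m_1}(w)$. (4) There is $M_0\ge M_*$ with $\Gamma_{M_*}(u)\cap S^k(w)\subseteq\Gamma_{M_0}^{S^k(w)}(u)$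 for all $w\in T,k\ge1,u\in S^k(w)$. (5) $\pi(\Gamma_{M_*+1}(w))\subseteq\Gamma_{M_*}(\pi(w))$ for all $w\in T$. Constants. For $A\subseteq T_n$ and $f:A\to\mathbb R$, $\mathcal E^n_{p,A}(f)=\frac12\sum_{u,v\in A,(u,v)\in E_n^*}|f(u)-f(v)|^p$. For $A_1,A_2\subseteq A\subseteq T_n$, $\mathcal E_{p,m}(A_1,A_2,A)=\inf\{\mathcal E^{n+m}_{p,S^m(A)}(f): f:S^m(A)\to\mathbb R, f|_{S^m(A_1)}\equiv1,f|_{S^m(A_2)}\equiv0\}$. For $w\in A$, $\mathcal E_{M,p,m}(w,A)=\mathcal E_{p,m}(\{w\},A\setminus\Gamma_M^A(w),A)$. Set $\mathcal E_{M_*,p,m}=\sup_{w\in T,|w|\ge1}\mathcal E_{M_*,p,m}(w,T_{|w|})$. For $A\subseteq T_n$, $(f)_A=\big(\sum_{v\in A}f(v)\mu(K_v)\big)/\sum_{v\in A}\mu(K_v)$. For $(w,v)\in E_n^*$, $\sigma_{p,m}(w,v)=\sup_f |(f)_{S^m(w)}-(f)_{S^m(v)}|^p/\mathcal E^{n+m}_{p,S^m(w)\cup S^m(v)}(f)$, the supremum over non-constant $f:S^m(w)\cup S^m(v)\to\mathbb R$; $\sigma_{p,m}=\sup_{n\ge1}\sup_{(w,v)\in E_n^*}\sigma_{p,m}(w,v)$. $K$ is $p$-conductively homogeneous if $\sup_{m\ge0}\sigma_{p,m}\,\mathcal E_{M_*,p,m}<\infty$. $\dim_{AR}(K,d)$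 (Ahlfors regular conformal dimension) is the infimum of all $\alpha$ for which there exist a metric $\rho$ on $K$ quasisymmetric to $d$ and a Borel regular measure that is $\alpha$-Ahlfors regular with respect to $\rho$. *)

theory Defs
  imports "HOL-Probability.Probability"
begin

section \<open>Rooted trees\<close>

record 't rooted_graph =
  tverts :: "'t set"
  tedges :: "('t \<times> 't) set"
  troot  :: "'t"

definition walk :: "('t, 'z) rooted_graph_scheme \<Rightarrow> 't \<Rightarrow> 't list \<Rightarrow> 't \<Rightarrow> bool" where
  "walk G u xs v \<longleftrightarrow> xs \<noteq> [] \<and> hd xs = u \<and> last xs = v \<and> set xs \<subseteq> tverts G \<and>
     successively (\<lambda>a b. (a, b) \<in> tedges G) xs"

definition gdist :: "('t, 'z) rooted_graph_scheme \<Rightarrow> 't \<Rightarrow> 't \<Rightarrow> nat" where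
  "gdist G u v = (LEAST n. \<exists>xs. walk G u xs v \<and> length xs = Suc n)"

definition rooted_tree :: "('t, 'z) rooted_graph_scheme \<Rightarrow> bool" where
  "rooted_tree G \<longleftrightarrow>
     countable (tverts G) \<and> infinite (tverts G) \<and> troot G \<in> tverts G \<and>
     tedges G \<subseteq> tverts G \<times> tverts G \<and> sym (tedges G) \<and> irrefl (tedges G) \<and>
     (\<forall>u\<in>tverts G. \<forall>v\<in>tverts G. \<exists>!xs. walk G u xs v \<and> distinct xs) \<and>
     (\<forall>w\<in>tverts G. finite (tedges G `` {w}) \<and> card (tedges G `` {w}) \<ge> 2)"

definition vheight :: "('t, 'z) rooted_graph_scheme \<Rightarrow> 't \<Rightarrow> nat" where
  "vheight G w = gdist G w (troot G)"

definition level :: "('t, 'z) rooted_graph_scheme \<Rightarrow> nat \<Rightarrow> 't set" where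
  "level G n = {w \<in> tverts G. vheight G w = n}"

definition parent :: "('t, 'z) rooted_graph_scheme \<Rightarrow> 't \<Rightarrow> 't" where
  "parent G w = (if w = troot G then troot G
     else (THE v. (w, v) \<in> tedges G \<and> vheight G w = Suc (vheight G v)))"

definition children :: "('t, 'z) rooted_graph_scheme \<Rightarrow> 't \<Rightarrow> 't set" where
  "children G w = {v \<in> tverts G. v \<noteq> troot G \<and> parent G v = w}"

primrec desc :: "('t, 'z) rooted_graph_scheme \<Rightarrow> nat \<Rightarrow> 't \<Rightarrow> 't set" where
  "desc G 0 w = {w}"
| "desc G (Suc k) w = (\<Union>v\<in>children G w. desc G k v)"

definition desc_set :: "('t, 'z) rooted_graph_scheme \<Rightarrow> nat \<Rightarrow> 't set \<Rightarrow> 't set" where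
  "desc_set G k A = (\<Union>w\<in>A. desc G k w)"


section \<open>Partitions parametrized by a rooted tree\<close>

text \<open>Throughout, \<open>P w\<close> is the cell \<open>K\<^sub>w\<close>.\<close>

definition tree_partition ::
    "('t, 'z) rooted_graph_scheme \<Rightarrow> 'k topology \<Rightarrow> ('t \<Rightarrow> 'k set) \<Rightarrow> bool" where
  "tree_partition G X P \<longleftrightarrow>
     (\<forall>w\<in>tverts G. P w \<noteq> {} \<and> compactin X (P w) \<and> P w \<subseteq> X derived_set_of (P w)) \<and>
     P (troot G) = topspace X \<and>
     (\<forall>w\<in>tverts G. P w = (\<Union>v\<in>children G w. P v)) \<and>
     (\<forall>\<omega>::nat \<Rightarrow> 't. (\<forall>i. \<omega> i \<in> level G i \<and> parent G (\<omega> (Suc i)) = \<omega> i) \<longrightarrow>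
        (\<exists>x. (\<Inter>i. P (\<omega> i)) = {x}))"

definition chain_nbhd :: "('t \<Rightarrow> 'k set) \<Rightarrow> 't set \<Rightarrow> nat \<Rightarrow> 't \<Rightarrow> 't set" where
  "chain_nbhd P A M w = {u \<in> A. \<exists>c::nat \<Rightarrow> 't. c 0 = w \<and> c M = u \<and>
     (\<forall>i\<le>M. c i \<in> A) \<and> (\<forall>i<M. P (c i) \<inter> P (c (Suc i)) \<noteq> {})}"

definition level_nbhd ::
    "('t, 'z) rooted_graph_scheme \<Rightarrow> ('t \<Rightarrow> 'k set) \<Rightarrow> nat \<Rightarrow> 't \<Rightarrow> 't set" where
  "level_nbhd G P M w = chain_nbhd P (level G (vheight G w)) M w"

definition minimal_partition ::
    "('t, 'z) rooted_graph_scheme \<Rightarrow> ('t \<Rightarrow> 'k set) \<Rightarrow> bool" where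
  "minimal_partition G P \<longleftrightarrow>
     (\<forall>w\<in>tverts G. P w - (\<Union>v\<in>level G (vheight G w) - {w}. P v) \<noteq> {})"

definition uniformly_finite ::
    "('t, 'z) rooted_graph_scheme \<Rightarrow> ('t \<Rightarrow> 'k set) \<Rightarrow> bool" where
  "uniformly_finite G P \<longleftrightarrow>
     (\<exists>N::nat. \<forall>w\<in>tverts G. finite (level_nbhd G P 1 w) \<and> card (level_nbhd G P 1 w) \<le> N)"

definition cell_edges ::
    "('t, 'z) rooted_graph_scheme \<Rightarrow> ('t \<Rightarrow> 'k set) \<Rightarrow> nat \<Rightarrow> ('t \<times> 't) set" where
  "cell_edges G P n = {(w, v) \<in> level G n \<times> level G n. w \<noteq> v \<and> P w \<inter> P v \<noteq> {}}"

definition cell_ball ::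
    "('t, 'z) rooted_graph_scheme \<Rightarrow> ('t \<Rightarrow> 'k set) \<Rightarrow> nat \<Rightarrow> 'k \<Rightarrow> nat \<Rightarrow> 'k set" where
  "cell_ball G P M x n = (\<Union>w\<in>{w \<in> level G n. x \<in> P w}. \<Union>v\<in>level_nbhd G P M w. P v)"


section \<open>Metrics and measures\<close>

text \<open>Only applied to non-empty bounded sets, where the real supremum is the true one.\<close>

definition diam :: "('k \<Rightarrow> 'k \<Rightarrow> real) \<Rightarrow> 'k set \<Rightarrow> real" where
  "diam d S = (SUP (x, y)\<in>S \<times> S. d x y)"

text \<open>The measurable sets may be a proper extension of the Borel sets (such as a completion), provided
  every measurable set has a Borel hull of the same measure.\<close>

definition borel_regular :: "'k topology \<Rightarrow> 'k measure \<Rightarrow> bool" where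
  "borel_regular X m \<longleftrightarrow>
     space m = topspace X \<and> sigma_sets (topspace X) {U. openin X U} \<subseteq> sets m \<and>
     (\<forall>A\<in>sets m. \<exists>B\<in>sigma_sets (topspace X) {U. openin X U}.
        A \<subseteq> B \<and> emeasure m A = emeasure m B)"

definition volume_doubling :: "'k set \<Rightarrow> ('k \<Rightarrow> 'k \<Rightarrow> real) \<Rightarrow> 'k measure \<Rightarrow> bool" where
  "volume_doubling K d m \<longleftrightarrow> (\<exists>C>0. \<forall>x\<in>K. \<forall>s>0.
     emeasure m (Metric_space.mball K d x (2 * s))
       \<le> ennreal C * emeasure m (Metric_space.mball K d x s))"

definition ahlfors_regular :: "'k set \<Rightarrow> ('k \<Rightarrow> 'k \<Rightarrow> real) \<Rightarrow> real \<Rightarrow> 'k measure \<Rightarrow> bool" where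
  "ahlfors_regular K \<rho> \<alpha> m \<longleftrightarrow> (\<exists>c1>0. \<exists>c2>0. \<forall>x\<in>K. \<forall>s. 0 < s \<and> s \<le> diam \<rho> K \<longrightarrow>
     ennreal (c1 * s powr \<alpha>) \<le> emeasure m (Metric_space.mball K \<rho> x s) \<and>
     emeasure m (Metric_space.mball K \<rho> x s) \<le> ennreal (c2 * s powr \<alpha>))"

definition quasisymmetric :: "'k set \<Rightarrow> ('k \<Rightarrow> 'k \<Rightarrow> real) \<Rightarrow> ('k \<Rightarrow> 'k \<Rightarrow> real) \<Rightarrow> bool" where
  "quasisymmetric K d \<rho> \<longleftrightarrow>
     Metric_space.mtopology K \<rho> = Metric_space.mtopology K d \<and>
     (\<exists>h g :: real \<Rightarrow> real. homeomorphism {0..} {0..} h g \<and>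
        (\<forall>x\<in>K. \<forall>y\<in>K. \<forall>z\<in>K. \<forall>t\<ge>0. d x z \<le> t * d x y \<longrightarrow> \<rho> x z \<le> h t * \<rho> x y))"

text \<open>Extended-real valued, so that the infimum of the empty set is \<open>\<infinity>\<close>.\<close>

definition dim_AR :: "'k set \<Rightarrow> ('k \<Rightarrow> 'k \<Rightarrow> real) \<Rightarrow> ereal" where
  "dim_AR K d = Inf (ereal ` {\<alpha>. \<exists>\<rho> m. Metric_space K \<rho> \<and> quasisymmetric K d \<rho> \<and>
     borel_regular (Metric_space.mtopology K \<rho>) m \<and> ahlfors_regular K \<rho> \<alpha> m})"


section \<open>The standing assumption\<close>

locale standing_assumption = Metric_space K d
  for K :: "'k set" and d :: "'k \<Rightarrow> 'k \<Rightarrow> real" +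
  fixes G :: "'t rooted_graph" and P :: "'t \<Rightarrow> 'k set" and \<mu> :: "'k measure"
    and Mstar :: nat and r :: real
  assumes tree: "rooted_tree G"
    and compact: "compact_space mtopology"
    and connected: "connected_space mtopology"
    and diam_K: "diam d K = 1"
    and partition: "tree_partition G mtopology P"
    and minimal: "minimal_partition G P"
    and unif_finite: "uniformly_finite G P"
    and connected_cells: "\<And>w. w \<in> tverts G \<Longrightarrow> connectedin mtopology (P w)"
    and Mstar_ge_1: "Mstar \<ge> 1"
    and r_bounds: "0 < r" "r < 1"
    and cell_diam: "\<exists>c1>0. \<exists>c2>0. \<forall>w\<in>tverts G.
          c1 * r ^ vheight G w \<le> diam d (P w) \<and> diam d (P w) \<le> c2 * r ^ vheight G w"
    and adapted: "\<exists>c1>0. \<exists>c2>0. \<forall>x\<in>K. \<forall>n\<ge>1.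
          mball x (c1 * r ^ n) \<subseteq> cell_ball G P Mstar x n \<and>
          cell_ball G P Mstar x n \<subseteq> mball x (c2 * r ^ n)"
    and thick: "\<exists>c>0. \<forall>n\<ge>1. \<forall>w\<in>level G n. \<exists>x\<in>P w. mball x (c * r ^ n) \<subseteq> P w"
    and prob: "prob_space \<mu>"
    and borel_reg: "borel_regular mtopology \<mu>"
    and doubling: "volume_doubling K d \<mu>"
    and additive: "\<And>w. w \<in> tverts G \<Longrightarrow>
          measure \<mu> (P w) = (\<Sum>v\<in>children G w. measure \<mu> (P v))"
    and exponential: "\<exists>\<gamma> \<gamma>1. \<exists>m1\<ge>1. 0 < \<gamma> \<and> \<gamma> < 1 \<and> 0 < \<gamma>1 \<and> \<gamma>1 < 1 \<and>
          (\<forall>w\<in>tverts G. measure \<mu> (P w) \<ge> \<gamma> * measure \<mu> (P (parent G w))) \<and>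
          (\<forall>w\<in>tverts G. \<forall>v\<in>desc G m1 w. measure \<mu> (P v) \<le> \<gamma>1 * measure \<mu> (P w))"
    and local_chains: "\<exists>M0\<ge>Mstar. \<forall>w\<in>tverts G. \<forall>k\<ge>1. \<forall>u\<in>desc G k w.
          level_nbhd G P Mstar u \<inter> desc G k w \<subseteq> chain_nbhd P (desc G k w) M0 u"
    and parent_nbhd: "\<And>w. w \<in> tverts G \<Longrightarrow>
          parent G ` level_nbhd G P (Mstar + 1) w \<subseteq> level_nbhd G P Mstar (parent G w)"


section \<open>Energies, conductances and the conductive homogeneity\<close>

definition energy :: "('t, 'z) rooted_graph_scheme \<Rightarrow> ('t \<Rightarrow> 'k set) \<Rightarrow> real \<Rightarrow> nat \<Rightarrow>
    't set \<Rightarrow> ('t \<Rightarrow> real) \<Rightarrow> real" where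
  "energy G P p n A f =
     1 / 2 * (\<Sum>(u, v)\<in>(A \<times> A) \<inter> cell_edges G P n. \<bar>f u - f v\<bar> powr p)"

text \<open>The level \<open>n\<close>, implicit in the usual notation through \<open>A \<subseteq> level G n\<close>, is an explicit argument.
  A function on a subset of the vertices is represented by any of its extensions; the energy does
  not depend on the extension.\<close>

definition conductance :: "('t, 'z) rooted_graph_scheme \<Rightarrow> ('t \<Rightarrow> 'k set) \<Rightarrow> real \<Rightarrow> nat \<Rightarrow> nat \<Rightarrow>
    't set \<Rightarrow> 't set \<Rightarrow> 't set \<Rightarrow> ennreal" where
  "conductance G P p n m A1 A2 A =
     (INF f\<in>{f :: 't \<Rightarrow> real. (\<forall>x\<in>desc_set G m A1. f x = 1) \<and> (\<forall>x\<in>desc_set G m A2. f x = 0)}.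
        ennreal (energy G P p (n + m) (desc_set G m A) f))"

definition nbhd_conductance :: "('t, 'z) rooted_graph_scheme \<Rightarrow> ('t \<Rightarrow> 'k set) \<Rightarrow> nat \<Rightarrow> real \<Rightarrow>
    nat \<Rightarrow> nat \<Rightarrow> 't \<Rightarrow> 't set \<Rightarrow> ennreal" where
  "nbhd_conductance G P M p n m w A = conductance G P p n m {w} (A - chain_nbhd P A M w) A"

definition sup_conductance :: "('t, 'z) rooted_graph_scheme \<Rightarrow> ('t \<Rightarrow> 'k set) \<Rightarrow> nat \<Rightarrow> real \<Rightarrow>
    nat \<Rightarrow> ennreal" where
  "sup_conductance G P M p m =
     (SUP w\<in>{w \<in> tverts G. vheight G w \<ge> 1}.
        nbhd_conductance G P M p (vheight G w) m w (level G (vheight G w)))"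

definition cell_mean :: "('t \<Rightarrow> 'k set) \<Rightarrow> 'k measure \<Rightarrow> 't set \<Rightarrow> ('t \<Rightarrow> real) \<Rightarrow> real" where
  "cell_mean P \<mu> A f = (\<Sum>v\<in>A. f v * measure \<mu> (P v)) / (\<Sum>v\<in>A. measure \<mu> (P v))"

definition pair_disparity :: "('t, 'z) rooted_graph_scheme \<Rightarrow> ('t \<Rightarrow> 'k set) \<Rightarrow> 'k measure \<Rightarrow>
    real \<Rightarrow> nat \<Rightarrow> nat \<Rightarrow> 't \<Rightarrow> 't \<Rightarrow> ennreal" where
  "pair_disparity G P \<mu> p n m w v =
     (SUP f\<in>{f :: 't \<Rightarrow> real. \<not> f constant_on (desc G m w \<union> desc G m v)}.
        ennreal (\<bar>cell_mean P \<mu> (desc G m w) f - cell_mean P \<mu> (desc G m v) f\<bar> powr p) /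
        ennreal (energy G P p (n + m) (desc G m w \<union> desc G m v) f))"

definition disparity :: "('t, 'z) rooted_graph_scheme \<Rightarrow> ('t \<Rightarrow> 'k set) \<Rightarrow> 'k measure \<Rightarrow>
    real \<Rightarrow> nat \<Rightarrow> ennreal" where
  "disparity G P \<mu> p m =
     (SUP n\<in>{1..}. SUP (w, v)\<in>cell_edges G P n. pair_disparity G P \<mu> p n m w v)"

definition conductively_homogeneous :: "('t, 'z) rooted_graph_scheme \<Rightarrow> ('t \<Rightarrow> 'k set) \<Rightarrow>
    'k measure \<Rightarrow> nat \<Rightarrow> real \<Rightarrow> bool" where
  "conductively_homogeneous G P \<mu> Mstar p \<longleftrightarrow>
     (SUP m. disparity G P \<mu> p m * sup_conductance G P Mstar p m) < \<infinity>"

end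

theory Submission
  imports Defs
begin

text \<open>Write \<open>E\<^sub>m\<close> for the conductance constant and \<open>\<sigma>\<^sub>m\<close> for the neighbour disparity. If \<open>\<sigma>\<^sub>m E\<^sub>m\<close> is bounded,
  the means of a function that is 1 on \<open>S\<^sup>m(u)\<close> and 0 on \<open>S\<^sup>m(v)\<close> drop by 1 along a chain of boundedly many
  neighbouring cells in \<open>S\<^sup>k(w)\<close>, so its energy is at least a multiple of \<open>1 / \<sigma>\<^sub>m\<close>.

  Conversely, a quasisymmetric metric carrying an \<open>\<alpha>\<close>-Ahlfors regular measure with \<open>\<alpha> < p\<close> yields, for
  large \<open>k\<close>, cutoffs of the cells whose discrete slopes at generation \<open>k\<close> have arbitrarily small \<open>p\<close>-th power
  sum. Gluing these with optimal functions at scale \<open>l\<close> gives \<open>E\<^bsub>k+l\<^esub> \<le> 3\<^sup>-\<^sup>p E\<^sub>l\<close>. The local lower bound controls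
  the gap of a function between two cells of \<open>S\<^sup>k(w)\<close>, and passing from a cell to its \<open>k\<close>-th generation costs a
  factor of at most 3 in the oscillation; this factor is absorbed by the decay, so
  \<open>E\<^sub>m osc(f)\<^sup>p \<le> B \<E>(f)\<close> on \<open>S\<^sup>m(w)\<close> by induction on \<open>m\<close>. Comparing the means of two touching cells through a
  common edge bounds \<open>\<sigma>\<^sub>m E\<^sub>m\<close>.\<close>

section \<open>Heights and generations in a rooted tree\<close>

text \<open>The local hypothesis sees only functions that are constantly 1 on one cell and
  constantly 0 on another. After truncation it therefore controls the drop from the minimum of
  \<open>f\<close> over one cell to its maximum over another, never a full oscillation. A general
  difference splits into such a drop and two oscillations inside smaller cells; in p-th powers this
  costs 3^p, and decay by exactly 3^-p lets one constant \<open>B\<close> reproduce itself in the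
  induction. The decay rests on the gap between \<alpha> and p: slopes of size at most \<eta>
  satisfy sum slope^p \<le> \<eta>^(p-\<alpha>) sum slope^\<alpha>. The last sum is bounded by a
  ratio of masses independent of the generation, while quasisymmetry drives \<eta> to 0 uniformly
  over the cells. The geometric obstacle is that gluing spreads supports by \<open>Mstar\<close>
  cells of the finer generation, although the result must vanish outside the
  \<open>Mstar\<close>-neighbourhood of \<open>w\<close>. Each generation absorbs one surplus step
  of a chain, so the cutoffs are built at least \<open>Mstar + 2\<close> generations below
  \<open>w\<close>.\<close>

lemma walk_Cons:
  "walk G u (x # y # xs) v \<longleftrightarrow> u = x \<and> x \<in> tverts G \<and> (x, y) \<in> tedges G \<and> walk G y (y # xs) v"
  unfolding walk_def by auto

lemma vheight_le_walk: "walk G w xs (troot G) \<Longrightarrow> vheight G w \<le> length xs - 1"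
  unfolding vheight_def gdist_def
  by (rule Least_le, rule exI[of _ xs]) (auto simp: walk_def Suc_diff_le Suc_le_eq)

lemma vheight_le_walk_mem:
  "walk G w xs (troot G) \<Longrightarrow> z \<in> set xs \<Longrightarrow> vheight G z \<le> length xs - 1"
proof (induction xs arbitrary: w)
  case Nil
  then show ?case by simp
next
  case (Cons x xs)
  show ?case
  proof (cases "z = x")
    case True
    then show ?thesis using vheight_le_walk[OF Cons.prems(1)] Cons.prems(1) by (auto simp: walk_def)
  next
    case False
    then obtain y ys where xs: "xs = y # ys" using Cons.prems(2) by (cases xs) auto
    with Cons.prems have "walk G y xs (troot G)" by (simp add: walk_Cons)
    from Cons.IH[OF this] False Cons.prems(2) show ?thesis by auto
  qed
qed

context
  fixes G :: "('t, 'z) rooted_graph_scheme"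
  assumes tree: "rooted_tree G"
begin

lemma shortest_walk:
  assumes "w \<in> tverts G"
  obtains xs where "walk G w xs (troot G)" "length xs = Suc (vheight G w)"
proof -
  have "troot G \<in> tverts G" "\<forall>u\<in>tverts G. \<forall>v\<in>tverts G. \<exists>!xs. walk G u xs v \<and> distinct xs"
    using tree by (auto simp: rooted_tree_def)
  with assms obtain xs where "walk G w xs (troot G)" by blast
  then have "\<exists>n. \<exists>xs. walk G w xs (troot G) \<and> length xs = Suc n"
    by (intro exI[of _ "length xs - 1"] exI[of _ xs]) (auto simp: walk_def Suc_diff_le Suc_le_eq)
  from LeastI_ex[OF this] show ?thesis
    using that unfolding vheight_def gdist_def by blast
qed

lemma vheight_edge:
  assumes "(a, b) \<in> tedges G" shows "vheight G a \<le> Suc (vheight G b)"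
proof -
  have ab: "a \<in> tverts G" "b \<in> tverts G" using assms tree by (auto simp: rooted_tree_def)
  obtain xs where xs: "walk G b xs (troot G)" "length xs = Suc (vheight G b)"
    using shortest_walk[OF ab(2)] .
  then obtain ys where "xs = b # ys" by (cases xs) (auto simp: walk_def)
  with xs ab assms have "walk G a (a # xs) (troot G)" by (simp add: walk_Cons)
  from vheight_le_walk[OF this] xs show ?thesis by simp
qed

text \<open>Heights drop by exactly one along a shortest walk, and every vertex of the tail is
  bounded in height by the length of the tail, so the head cannot recur there.\<close>

lemma shortest_walk_distinct:
  "walk G w xs (troot G) \<Longrightarrow> length xs = Suc (vheight G w) \<Longrightarrow> distinct xs"
proof (induction xs arbitrary: w)
  case Nil
  then show ?case by simp
next
  case (Cons x xs)
  show ?case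
  proof (cases xs)
    case Nil
    then show ?thesis by simp
  next
    case (Cons y ys)
    with Cons.prems have w: "w = x" "(x, y) \<in> tedges G" "walk G y xs (troot G)"
      by (auto simp: walk_Cons)
    have "vheight G x \<le> Suc (vheight G y)" "vheight G y \<le> length xs - 1"
      using vheight_edge[OF w(2)] vheight_le_walk[OF w(3)] by auto
    then have "length xs = Suc (vheight G y)" using Cons.prems w Cons by auto
    with Cons.IH w have "distinct xs" by blast
    moreover have "x \<notin> set xs"
      using vheight_le_walk_mem[OF w(3), of x] Cons.prems w Cons by auto
    ultimately show ?thesis by simp
  qed
qed

lemma root_in: "troot G \<in> tverts G"
  using tree by (simp add: rooted_tree_def)

lemma vheight_root: "vheight G (troot G) = 0"
  using vheight_le_walk[of G "troot G" "[troot G]"] root_in by (simp add: walk_def)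

lemma vheight_eq_0_iff: "w \<in> tverts G \<Longrightarrow> vheight G w = 0 \<longleftrightarrow> w = troot G"
proof
  assume "w \<in> tverts G" "vheight G w = 0"
  then obtain xs where "walk G w xs (troot G)" "length xs = 1" using shortest_walk by force
  then show "w = troot G" by (auto simp: walk_def length_Suc_conv)
qed (simp add: vheight_root)

text \<open>Two candidates \<open>a\<close> and \<open>b\<close> extend to two shortest walks from
  \<open>w\<close> to the root. Both have distinct vertices, so uniqueness of simple paths forces
  them to agree in their second vertex. This justifies the definite description in
  \<open>parent\<close>.\<close>

lemma parent_unique:
  assumes "w \<in> tverts G" "w \<noteq> troot G"
  shows "\<exists>!v. (w, v) \<in> tedges G \<and> vheight G w = Suc (vheight G v)"
proof -
  obtain xs where xs: "walk G w xs (troot G)" "length xs = Suc (vheight G w)"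
    using shortest_walk[OF assms(1)] .
  then obtain y ys where xsy: "xs = w # y # ys"
    using assms by (cases xs rule: remdups_adj.cases) (auto simp: walk_def)
  then have y: "(w, y) \<in> tedges G" "walk G y (y # ys) (troot G)" using xs by (auto simp: walk_Cons)
  have "vheight G w = Suc (vheight G y)"
    using vheight_le_walk[OF y(2)] vheight_edge[OF y(1)] xs xsy by simp
  moreover have "a = b" if a: "(w, a) \<in> tedges G" "vheight G w = Suc (vheight G a)"
    and b: "(w, b) \<in> tedges G" "vheight G w = Suc (vheight G b)" for a b
  proof -
    have *: "\<exists>zs. walk G w (w # c # zs) (troot G) \<and> distinct (w # c # zs)"
      if c: "(w, c) \<in> tedges G" "vheight G w = Suc (vheight G c)" for c
    proof -
      have "c \<in> tverts G" using c tree by (auto simp: rooted_tree_def)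
      then obtain zs where zs: "walk G c zs (troot G)" "length zs = Suc (vheight G c)"
        using shortest_walk by blast
      then obtain zs' where zs': "zs = c # zs'" by (cases zs) (auto simp: walk_def)
      then have "walk G w (w # c # zs') (troot G)" using zs c assms by (simp add: walk_Cons)
      then show ?thesis using shortest_walk_distinct zs zs' c by (metis length_Cons)
    qed
    obtain za zb where "walk G w (w # a # za) (troot G)" "distinct (w # a # za)"
      "walk G w (w # b # zb) (troot G)" "distinct (w # b # zb)" using *[OF a] *[OF b] by blast
    moreover have "\<exists>!xs. walk G w xs (troot G) \<and> distinct xs"
      using tree assms(1) root_in by (auto simp: rooted_tree_def)
    ultimately have "w # a # za = w # b # zb" by blast
    then show ?thesis by simp
  qed
  ultimately show ?thesis using y(1) by blast
qed

lemma parent_edge: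
  assumes "w \<in> tverts G" "w \<noteq> troot G"
  shows "(w, parent G w) \<in> tedges G" "vheight G w = Suc (vheight G (parent G w))"
  using theI'[OF parent_unique[OF assms]] assms(2) by (auto simp: parent_def)

lemma parent_level: "w \<in> level G (Suc n) \<Longrightarrow> parent G w \<in> level G n"
proof -
  assume w: "w \<in> level G (Suc n)"
  then have "w \<in> tverts G" "w \<noteq> troot G" using vheight_root by (auto simp: level_def)
  with parent_edge[of w] tree w show ?thesis
    by (auto simp: level_def rooted_tree_def)
qed

lemma parent_pow_level: "w \<in> level G (n + k) \<Longrightarrow> (parent G ^^ k) w \<in> level G n"
  by (induction k arbitrary: w) (auto simp: parent_level funpow_swap1)

lemma children_eq:
  assumes "w \<in> tverts G"
  shows "children G w = {v \<in> level G (Suc (vheight G w)). parent G v = w}"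
  using parent_edge vheight_root by (fastforce simp: children_def level_def)

lemma finite_children: "w \<in> tverts G \<Longrightarrow> finite (children G w)"
proof (rule finite_subset)
  assume w: "w \<in> tverts G"
  show "finite (tedges G `` {w})" using tree w by (auto simp: rooted_tree_def)
  show "children G w \<subseteq> tedges G `` {w}"
    using parent_edge tree by (auto simp: children_def rooted_tree_def dest: symD)
qed

text \<open>Trades the downward recursion for iterated parents; disjointness of the descendants of
  different vertices and the bookkeeping of heights are read off from this form.\<close>

lemma desc_eq:
  "w \<in> tverts G \<Longrightarrow> desc G k w = {v \<in> level G (vheight G w + k). (parent G ^^ k) v = w}"
proof (induction k arbitrary: w)
  case 0
  then show ?case by (auto simp: level_def)
next
  case (Suc k)
  have ch: "v \<in> tverts G \<and> vheight G v = Suc (vheight G w)" if "v \<in> children G w" for v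
    using that by (auto simp: children_eq[OF Suc.prems] level_def)
  have "desc G (Suc k) w = (\<Union>v\<in>children G w. {x \<in> level G (vheight G w + Suc k). (parent G ^^ k) x = v})"
    using Suc.IH ch by auto
  also have "\<dots> = {x \<in> level G (vheight G w + Suc k). (parent G ^^ k) x \<in> children G w}" by auto
  also have "\<dots> = {x \<in> level G (vheight G w + Suc k). (parent G ^^ Suc k) x = w}"
    using parent_pow_level[of _ "Suc (vheight G w)" k] by (auto simp: children_eq[OF Suc.prems])
  finally show ?case .
qed

lemma finite_desc: "w \<in> tverts G \<Longrightarrow> finite (desc G k w)"
proof (induction k arbitrary: w)
  case (Suc k)
  then show ?case using finite_children by (auto simp: children_eq level_def)
qed simp

lemma level_0: "level G 0 = {troot G}"
  using vheight_eq_0_iff root_in vheight_root by (auto simp: level_def)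

lemma level_eq_desc: "level G n = desc G n (troot G)"
  using parent_pow_level[of _ 0 n] by (auto simp: desc_eq root_in vheight_root level_0)

lemma finite_level: "finite (level G n)"
  by (simp add: level_eq_desc finite_desc root_in)

lemma desc_level: "w \<in> level G n \<Longrightarrow> desc G k w \<subseteq> level G (n + k)"
  by (auto simp: desc_eq level_def)

lemma mem_desc_ancestor: "x \<in> level G (n + k) \<Longrightarrow> x \<in> desc G k ((parent G ^^ k) x)"
  using parent_pow_level[of x n k] by (auto simp: desc_eq level_def)

lemma ancestor_unique: "w \<in> tverts G \<Longrightarrow> x \<in> desc G k w \<Longrightarrow> (parent G ^^ k) x = w"
  by (simp add: desc_eq)

lemma desc_add: "desc G (k + m) w = desc_set G m (desc G k w)"
  by (induction k arbitrary: w) (auto simp: desc_set_def)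

lemma desc_set_level: "desc_set G k (level G n) = level G (n + k)"
  by (simp add: level_eq_desc desc_add)

end

section \<open>Chains of cells\<close>

text \<open>In contrast to \<open>cell_edges\<close>, pairs with \<open>u = v\<close> are kept, so
  that chains can be padded to a prescribed length, and \<open>A\<close> may be any set of cells.
  Relational powers then express chains.\<close>

definition touching :: "('t \<Rightarrow> 'k set) \<Rightarrow> 't set \<Rightarrow> ('t \<times> 't) set" where
  "touching P A = {(u, v). u \<in> A \<and> v \<in> A \<and> P u \<inter> P v \<noteq> {}}"

lemma touching_sym: "(u, v) \<in> touching P A ^^ k \<Longrightarrow> (v, u) \<in> touching P A ^^ k"
proof (induction k arbitrary: v)
  case (Suc k)
  then obtain y where "(u, y) \<in> touching P A ^^ k" "(y, v) \<in> touching P A" by auto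
  then have "(v, y) \<in> touching P A" "(y, u) \<in> touching P A ^^ k"
    using Suc.IH by (auto simp: touching_def)
  then show ?case by (rule relpow_Suc_I2)
qed simp

lemma touching_pow_mem: "(u, v) \<in> touching P A ^^ k \<Longrightarrow> u \<in> A \<Longrightarrow> v \<in> A"
  by (cases k) (auto simp: touching_def)

text \<open>Edges of \<open>touching P A\<close> already place every later vertex of a chain in
  \<open>A\<close>; membership of the first one has to be supplied, since the zeroth relational
  power is the full identity.\<close>

lemma chain_nbhd_eq:
  assumes "w \<in> A" shows "chain_nbhd P A k w = {u. (w, u) \<in> touching P A ^^ k}"
proof -
  have "u \<in> A \<and> (\<forall>i\<le>k. c i \<in> A) \<and> (\<forall>i<k. P (c i) \<inter> P (c (Suc i)) \<noteq> {}) \<longleftrightarrow>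
      (\<forall>i<k. (c i, c (Suc i)) \<in> touching P A)" if "c 0 = w" "c k = u" for c u
  proof -
    have "c i \<in> A" if "i \<le> k" "\<forall>i<k. (c i, c (Suc i)) \<in> touching P A" for i
    proof (cases i)
      case (Suc j)
      with that have "(c j, c (Suc j)) \<in> touching P A" by simp
      with Suc show ?thesis by (simp add: touching_def)
    qed (use \<open>c 0 = w\<close> assms in simp)
    note mem = this
    show ?thesis
    proof
      assume "\<forall>i<k. (c i, c (Suc i)) \<in> touching P A"
      with mem \<open>c k = u\<close> show "u \<in> A \<and> (\<forall>i\<le>k. c i \<in> A) \<and> (\<forall>i<k. P (c i) \<inter> P (c (Suc i)) \<noteq> {})"
        unfolding touching_def by blast
    qed (simp add: touching_def)
  qed
  note step = this
  show ?thesis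
  proof (intro set_eqI iffI)
    fix u assume "u \<in> chain_nbhd P A k w"
    then obtain c where "c 0 = w" "c k = u" "u \<in> A \<and> (\<forall>i\<le>k. c i \<in> A) \<and> (\<forall>i<k. P (c i) \<inter> P (c (Suc i)) \<noteq> {})"
      unfolding chain_nbhd_def by blast
    with step[OF this(1,2)] show "u \<in> {u. (w, u) \<in> touching P A ^^ k}"
      unfolding relpow_fun_conv by blast
  next
    fix u assume "u \<in> {u. (w, u) \<in> touching P A ^^ k}"
    then obtain c where "c 0 = w" "c k = u" "\<forall>i<k. (c i, c (Suc i)) \<in> touching P A"
      unfolding relpow_fun_conv by blast
    with step[OF this(1,2)] show "u \<in> chain_nbhd P A k w"
      unfolding chain_nbhd_def by blast
  qed
qed

lemma level_nbhd_eq: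
  "w \<in> level G n \<Longrightarrow> level_nbhd G P k w = {u. (w, u) \<in> touching P (level G n) ^^ k}"
  by (simp add: level_nbhd_def chain_nbhd_eq level_def)

text \<open>The bound counts touching pairs. Being quadratic is harmless: only its uniformity over
  all cells matters later.\<close>

lemma touching_trancl_le_card:
  assumes "finite A" "(u, v) \<in> (touching P A)\<^sup>*"
  obtains k where "k \<le> (card A)\<^sup>2" "(u, v) \<in> touching P A ^^ k"
proof -
  have sub: "touching P A \<subseteq> A \<times> A" by (auto simp: touching_def)
  with assms(1) have fin: "finite (touching P A)" using finite_subset by blast
  have "card (touching P A) \<le> card (A \<times> A)" using sub assms(1) by (intro card_mono) auto
  then have "card (touching P A) \<le> (card A)\<^sup>2" by (simp add: card_cartesian_product power2_eq_square)
  moreover have "(u, v) \<in> (\<Union>n\<in>{n. n \<le> card (touching P A)}. touching P A ^^ n)"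
    using assms(2) rtrancl_finite_eq_relpow[OF fin] by simp
  ultimately show ?thesis using that by (auto intro: order_trans)
qed


section \<open>Energy estimates\<close>

lemma energy_nonneg: "0 \<le> energy G P p n A f"
  by (auto simp: energy_def intro!: sum_nonneg)

lemma energy_mono_set: "A \<subseteq> B \<Longrightarrow> finite B \<Longrightarrow> energy G P p n A f \<le> energy G P p n B f"
  unfolding energy_def by (intro mult_left_mono sum_mono2) auto

text \<open>The energy runs over ordered pairs, so the two orientations of the edge together cancel
  the factor 1/2.\<close>

lemma edge_le_energy:
  assumes "finite A" "A \<subseteq> level G n" "(u, v) \<in> touching P A"
  shows "\<bar>f u - f v\<bar> powr p \<le> energy G P p n A f"
proof (cases "u = v")
  case True
  then show ?thesis using energy_nonneg by simp
next
  case False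
  let ?E = "(A \<times> A) \<inter> cell_edges G P n"
  have "(\<Sum>(u, v)\<in>{(u, v), (v, u)}. \<bar>f u - f v\<bar> powr p) \<le> (\<Sum>(u, v)\<in>?E. \<bar>f u - f v\<bar> powr p)"
    using assms False by (intro sum_mono2) (auto simp: touching_def cell_edges_def)
  then show ?thesis using False by (simp add: energy_def abs_minus_commute)
qed

lemma path_le_energy:
  assumes "finite A" "A \<subseteq> level G n" "0 < p" "(u, v) \<in> touching P A ^^ k"
  shows "\<bar>f u - f v\<bar> \<le> k * energy G P p n A f powr (1 / p)"
  using assms(4)
proof (induction k arbitrary: v)
  case 0
  then show ?case by simp
next
  case (Suc k)
  then obtain y where y: "(u, y) \<in> touching P A ^^ k" "(y, v) \<in> touching P A" by auto
  have "\<bar>f y - f v\<bar> = (\<bar>f y - f v\<bar> powr p) powr (1 / p)"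
    using assms(3) by (simp add: powr_powr)
  also have "\<dots> \<le> energy G P p n A f powr (1 / p)"
    using edge_le_energy[OF assms(1,2) y(2)] assms(3) by (intro powr_mono2) auto
  finally show ?case using Suc.IH[OF y(1)] by (simp add: algebra_simps)
qed

lemma connected_le_energy:
  assumes "finite A" "A \<subseteq> level G n" "0 < p" "(u, v) \<in> (touching P A)\<^sup>*"
  shows "\<bar>f u - f v\<bar> powr p \<le> real ((card A)\<^sup>2) powr p * energy G P p n A f"
proof -
  obtain k where k: "k \<le> (card A)\<^sup>2" "(u, v) \<in> touching P A ^^ k"
    using touching_trancl_le_card[OF assms(1,4)] .
  have "\<bar>f u - f v\<bar> \<le> real ((card A)\<^sup>2) * energy G P p n A f powr (1 / p)"
    using path_le_energy[OF assms(1-3) k(2), of f] k(1)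
    by (smt (verit) mult_right_mono of_nat_mono powr_ge_zero)
  then have "\<bar>f u - f v\<bar> powr p \<le> (real ((card A)\<^sup>2) * energy G P p n A f powr (1 / p)) powr p"
    using assms(3) by (intro powr_mono2) auto
  also have "\<dots> = real ((card A)\<^sup>2) powr p * energy G P p n A f"
    using assms(3) energy_nonneg[of G P p n A f] by (simp add: powr_mult powr_powr)
  finally show ?thesis .
qed

text \<open>Truncation to [0, 1] is 1-Lipschitz, so only the rescaling by \<open>t\<close> enters.
  This turns an arbitrary function into a competitor for a conductance.\<close>

lemma energy_clamp_scale:
  assumes "t > 0" "0 < p"
  shows "energy G P p n A (\<lambda>x. max 0 (min 1 ((f x - b) / t))) \<le> energy G P p n A f / t powr p"
proof -
  have *: "\<bar>max 0 (min 1 ((f u - b) / t)) - max 0 (min 1 ((f v - b) / t))\<bar> powr p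
      \<le> \<bar>f u - f v\<bar> powr p / t powr p" for u v
  proof -
    have "\<bar>max 0 (min 1 x) - max 0 (min 1 y)\<bar> \<le> \<bar>x - y\<bar>" for x y :: real by auto
    then have "\<bar>max 0 (min 1 ((f u - b) / t)) - max 0 (min 1 ((f v - b) / t))\<bar>
        \<le> \<bar>(f u - b) / t - (f v - b) / t\<bar>" .
    also have "\<dots> = \<bar>f u - f v\<bar> / t" using assms(1) by (simp add: diff_divide_distrib[symmetric])
    finally have "\<bar>max 0 (min 1 ((f u - b) / t)) - max 0 (min 1 ((f v - b) / t))\<bar> powr p
        \<le> (\<bar>f u - f v\<bar> / t) powr p"
      using assms(2) by (intro powr_mono2) auto
    then show ?thesis using assms(1) by (simp add: powr_divide)
  qed
  show ?thesis
    unfolding energy_def times_divide_eq_right[symmetric] sum_divide_distrib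
    by (intro mult_left_mono sum_mono) (auto simp: *)
qed


section \<open>Cells under the standing assumption\<close>

context standing_assumption
begin

lemmas in_tree = root_in[OF tree] finite_level[OF tree] finite_desc[OF tree]

lemma desc_tverts: "w \<in> tverts G \<Longrightarrow> desc G k w \<subseteq> tverts G"
  using desc_eq[OF tree] by (auto simp: level_def)

lemma desc_subset_level: "w \<in> level G n \<Longrightarrow> desc G k w \<subseteq> level G (n + k)"
  using desc_level[OF tree] .

lemma tverts_level: "w \<in> level G n \<Longrightarrow> w \<in> tverts G"
  by (simp add: level_def)

lemma level_self: "w \<in> tverts G \<Longrightarrow> w \<in> level G (vheight G w)"
  by (simp add: level_def)

lemma P_children: "w \<in> tverts G \<Longrightarrow> P w = (\<Union>v\<in>children G w. P v)"
  using partition by (simp add: tree_partition_def)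

lemma P_nonempty: "w \<in> tverts G \<Longrightarrow> P w \<noteq> {}"
  using partition unfolding tree_partition_def by blast

lemma P_desc: "w \<in> tverts G \<Longrightarrow> P w = (\<Union>v\<in>desc G k w. P v)"
proof (induction k arbitrary: w)
  case (Suc k)
  have "v \<in> tverts G" if "v \<in> children G w" for v using that by (simp add: children_def)
  then show ?case using Suc P_children[OF Suc.prems] by simp
qed simp

lemma desc_nonempty: "w \<in> tverts G \<Longrightarrow> desc G k w \<noteq> {}"
  using P_desc P_nonempty by (metis UN_empty)

lemma P_root: "P (troot G) = K"
  using partition by (simp add: tree_partition_def)

lemma P_level: "(\<Union>v\<in>level G n. P v) = K"
  using P_desc[OF in_tree(1), of n] level_eq_desc[OF tree] P_root by simp

lemma P_subset: "w \<in> tverts G \<Longrightarrow> P w \<subseteq> K"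
  using P_level[of "vheight G w"] level_self[of w] by blast

lemma P_closedin: "w \<in> tverts G \<Longrightarrow> closedin mtopology (P w)"
  using partition compactin_imp_closedin[OF Hausdorff_space_mtopology]
  unfolding tree_partition_def by blast

lemma P_ancestor:
  "x \<in> level G (n + k) \<Longrightarrow> P x \<subseteq> P ((parent G ^^ k) x)"
  using P_desc[of "(parent G ^^ k) x" k] mem_desc_ancestor[OF tree, of x n k]
    tverts_level[OF parent_pow_level[OF tree, of x n k]] by blast

text \<open>The cells reachable from \<open>u\<close> and the remaining ones have disjoint unions,
  both closed because \<open>A\<close> is finite; two nonempty parts would disconnect the whole
  union.\<close>

lemma connected_imp_chain:
  assumes "A \<subseteq> tverts G" "finite A" "connectedin mtopology (\<Union>w\<in>A. P w)" "u \<in> A" "v \<in> A"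
  shows "(u, v) \<in> (touching P A)\<^sup>*"
proof (rule ccontr)
  assume nuv: "(u, v) \<notin> (touching P A)\<^sup>*"
  define B where "B = {x \<in> A. (u, x) \<in> (touching P A)\<^sup>*}"
  have "closedin mtopology (\<Union>w\<in>B. P w)" "closedin mtopology (\<Union>w\<in>A - B. P w)"
    using assms(1,2) P_closedin by (auto simp: B_def intro!: closedin_Union)
  moreover have "(\<Union>w\<in>A. P w) \<subseteq> (\<Union>w\<in>B. P w) \<union> (\<Union>w\<in>A - B. P w)" by auto
  moreover have "P x \<inter> P y = {}" if "x \<in> B" "y \<in> A - B" for x y
  proof (rule ccontr)
    assume "P x \<inter> P y \<noteq> {}"
    with that have "(x, y) \<in> touching P A" "(u, x) \<in> (touching P A)\<^sup>*"
      by (auto simp: touching_def B_def)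
    then have "(u, y) \<in> (touching P A)\<^sup>*" by (rule rtrancl.rtrancl_into_rtrancl[rotated])
    with that show False by (auto simp: B_def)
  qed
  then have "(\<Union>w\<in>B. P w) \<inter> (\<Union>w\<in>A - B. P w) \<inter> (\<Union>w\<in>A. P w) = {}" by blast
  ultimately have "(\<Union>w\<in>B. P w) \<inter> (\<Union>w\<in>A. P w) = {} \<or> (\<Union>w\<in>A - B. P w) \<inter> (\<Union>w\<in>A. P w) = {}"
    using assms(3) unfolding connectedin_closedin by blast
  moreover have "u \<in> B" "v \<in> A - B" using assms nuv by (auto simp: B_def)
  moreover have "P u \<noteq> {}" "P v \<noteq> {}" using assms P_nonempty by auto
  ultimately show False using assms(4,5) by blast
qed

lemma desc_chain:
  assumes "w \<in> tverts G" "u \<in> desc G k w" "v \<in> desc G k w"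
  shows "(u, v) \<in> (touching P (desc G k w))\<^sup>*"
  using connected_imp_chain[OF desc_tverts in_tree(3) _ assms(2,3)] assms(1)
    connected_cells[OF assms(1)] P_desc[OF assms(1), of k] by simp

lemma desc_pair_chain:
  assumes "w \<in> tverts G" "w' \<in> tverts G" "P w \<inter> P w' \<noteq> {}"
    and "u \<in> desc G k w \<union> desc G k w'" "v \<in> desc G k w \<union> desc G k w'"
  shows "(u, v) \<in> (touching P (desc G k w \<union> desc G k w'))\<^sup>*"
proof (rule connected_imp_chain[OF _ _ _ assms(4,5)])
  have "connectedin mtopology (P w \<union> P w')"
    using connectedin_Un connected_cells assms(1-3) by blast
  then show "connectedin mtopology (\<Union>x\<in>desc G k w \<union> desc G k w'. P x)"
    using P_desc[OF assms(1), of k] P_desc[OF assms(2), of k] by (simp add: UN_Un)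
qed (use assms desc_tverts in_tree in auto)

lemma measure_desc_sum: "w \<in> tverts G \<Longrightarrow> measure \<mu> (P w) = (\<Sum>v\<in>desc G k w. measure \<mu> (P v))"
proof (induction k arbitrary: w)
  case 0
  then show ?case by simp
next
  case (Suc k)
  have ch: "v \<in> tverts G \<and> parent G v = w" if "v \<in> children G w" for v
    using that by (auto simp: children_def)
  have "measure \<mu> (P w) = (\<Sum>v\<in>children G w. \<Sum>x\<in>desc G k v. measure \<mu> (P x))"
    using additive[OF Suc.prems] Suc.IH ch by (simp cong: sum.cong)
  also have "\<dots> = (\<Sum>x\<in>(\<Union>v\<in>children G w. desc G k v). measure \<mu> (P x))"
  proof (intro sum.UNION_disjoint[symmetric] ballI impI)
    show "desc G k i \<inter> desc G k j = {}" if "i \<in> children G w" "j \<in> children G w" "i \<noteq> j" for i j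
      using ancestor_unique[OF tree, of i _ k] ancestor_unique[OF tree, of j _ k] ch that by auto
  qed (use ch finite_children[OF tree Suc.prems] finite_desc[OF tree] in auto)
  finally show ?case by simp
qed

lemma measure_root: "measure \<mu> (P (troot G)) = 1"
  using prob_space.prob_space[OF prob] borel_reg P_root by (simp add: borel_regular_def)

text \<open>Each descendant in generation k carries at least the fraction \<gamma>^k of the mass of
  \<open>w\<close>, and these masses add up to that of \<open>w\<close>; hence there are at most
  \<gamma>^-k of them. Positivity is the same estimate started at the root.\<close>

lemma measure_lower:
  obtains \<gamma> where "0 < \<gamma>" "\<gamma> < 1"
    "\<And>w. w \<in> tverts G \<Longrightarrow> 0 < measure \<mu> (P w)"
    "\<And>w k. w \<in> tverts G \<Longrightarrow> card (desc G k w) \<le> 1 / \<gamma> ^ k"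
proof -
  obtain \<gamma> where g: "0 < \<gamma>" "\<gamma> < 1" "\<And>w. w \<in> tverts G \<Longrightarrow> \<gamma> * measure \<mu> (P (parent G w)) \<le> measure \<mu> (P w)"
    using exponential by blast
  have pow: "\<gamma> ^ k * measure \<mu> (P w) \<le> measure \<mu> (P v)" if "w \<in> tverts G" "v \<in> desc G k w" for k w v
    using that
  proof (induction k arbitrary: w)
    case 0
    then show ?case by simp
  next
    case (Suc k)
    then obtain x where x: "x \<in> children G w" "v \<in> desc G k x" by auto
    then have x': "x \<in> tverts G" "parent G x = w" by (auto simp: children_def)
    have "\<gamma> ^ k * (\<gamma> * measure \<mu> (P w)) \<le> \<gamma> ^ k * measure \<mu> (P x)"
      using g(3)[OF x'(1)] x' g(1) by (intro mult_left_mono) auto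
    also have "\<dots> \<le> measure \<mu> (P v)" using Suc.IH[OF x'(1) x(2)] .
    finally show ?case by (simp add: mult_ac)
  qed
  have pos: "0 < measure \<mu> (P w)" if "w \<in> tverts G" for w
  proof -
    have "w \<in> desc G (vheight G w) (troot G)"
      using level_self[OF that] level_eq_desc[OF tree] by simp
    from pow[OF in_tree(1) this] show ?thesis using g(1) measure_root
      by (smt (verit) mult_pos_pos zero_less_power)
  qed
  have "card (desc G k w) \<le> 1 / \<gamma> ^ k" if w: "w \<in> tverts G" for w k
  proof -
    have "card (desc G k w) * (\<gamma> ^ k * measure \<mu> (P w)) \<le> (\<Sum>v\<in>desc G k w. measure \<mu> (P v))"
      using pow[OF w] by (intro sum_bounded_below) auto
    also have "\<dots> = 1 * measure \<mu> (P w)" using measure_desc_sum[OF w] by simp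
    finally have "card (desc G k w) * \<gamma> ^ k \<le> 1"
      using pos[OF w] by (simp add: mult.assoc[symmetric])
    then show ?thesis using g(1) by (simp add: field_simps)
  qed
  with g pos show ?thesis using that by blast
qed

lemma cell_mean_between:
  assumes "w \<in> tverts G" "\<And>x. x \<in> desc G k w \<Longrightarrow> a \<le> f x" "\<And>x. x \<in> desc G k w \<Longrightarrow> f x \<le> b"
  shows "a \<le> cell_mean P \<mu> (desc G k w) f" "cell_mean P \<mu> (desc G k w) f \<le> b"
proof -
  let ?S = "\<Sum>v\<in>desc G k w. measure \<mu> (P v)"
  have S: "?S > 0" using measure_desc_sum[OF assms(1)] measure_lower assms(1) by metis
  have "a * ?S \<le> (\<Sum>v\<in>desc G k w. f v * measure \<mu> (P v))"
    "(\<Sum>v\<in>desc G k w. f v * measure \<mu> (P v)) \<le> b * ?S"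
    unfolding sum_distrib_left using assms by (auto intro!: sum_mono mult_right_mono)
  with S show "a \<le> cell_mean P \<mu> (desc G k w) f" "cell_mean P \<mu> (desc G k w) f \<le> b"
    by (simp_all add: cell_mean_def field_simps)
qed

lemma cell_mean_const:
  assumes "w \<in> tverts G" "\<And>x. x \<in> desc G k w \<Longrightarrow> f x = a"
  shows "cell_mean P \<mu> (desc G k w) f = a"
  using cell_mean_between[OF assms(1), of k a f a] assms(2) by force

text \<open>All cells of a level through \<open>x\<close> touch any single one of them, so the
  pointwise count reduces to counting neighbours.\<close>

lemma overlap_bound:
  obtains N :: nat where "\<And>n w. w \<in> level G n \<Longrightarrow> card {u \<in> level G n. P w \<inter> P u \<noteq> {}} \<le> N"
    "\<And>n x. x \<in> K \<Longrightarrow> card {u \<in> level G n. x \<in> P u} \<le> N"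
proof -
  obtain N where N: "\<And>w. w \<in> tverts G \<Longrightarrow> card (level_nbhd G P 1 w) \<le> N"
    using unif_finite by (auto simp: uniformly_finite_def)
  have 1: "card {u \<in> level G n. P w \<inter> P u \<noteq> {}} \<le> N" if w: "w \<in> level G n" for n w
  proof -
    have "level_nbhd G P 1 w = {u \<in> level G n. P w \<inter> P u \<noteq> {}}"
      using w unfolding level_nbhd_eq[OF w] by (auto simp: touching_def)
    then show ?thesis using N[OF tverts_level[OF w]] by simp
  qed
  have "card {u \<in> level G n. x \<in> P u} \<le> N" if x: "x \<in> K" for n x
  proof -
    obtain w where w: "w \<in> level G n" "x \<in> P w" using x P_level[of n] by blast
    then have "card {u \<in> level G n. x \<in> P u} \<le> card {u \<in> level G n. P w \<inter> P u \<noteq> {}}"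
      using in_tree by (intro card_mono) auto
    with 1[OF w(1)] show ?thesis by simp
  qed
  with 1 show ?thesis using that by blast
qed

section \<open>Chains of touching cells under passage to ancestors\<close>

lemma touching_refl: "w \<in> level G n \<Longrightarrow> (w, w) \<in> touching P (level G n)"
  using P_nonempty tverts_level by (auto simp: touching_def)

lemma touching_pow_mono:
  assumes "(u, v) \<in> touching P (level G n) ^^ j" "j \<le> k" "u \<in> level G n"
  shows "(u, v) \<in> touching P (level G n) ^^ k"
  using assms(2,1)
proof (induction k rule: dec_induct)
  case (step k)
  then show ?case using touching_refl[OF touching_pow_mem[OF _ assms(3)]] by auto
qed

lemma touching_parent_pow:
  assumes "(u, v) \<in> touching P (level G (n + j)) ^^ k" "u \<in> level G (n + j)"
  shows "((parent G ^^ j) u, (parent G ^^ j) v) \<in> touching P (level G n) ^^ k"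
  using assms(1)
proof (induction k arbitrary: v)
  case (Suc k)
  then obtain y where y: "(u, y) \<in> touching P (level G (n + j)) ^^ k"
    "(y, v) \<in> touching P (level G (n + j))" by auto
  then have "((parent G ^^ j) y, (parent G ^^ j) v) \<in> touching P (level G n)"
    using P_ancestor[of y n j] P_ancestor[of v n j] parent_pow_level[OF tree, of y n j]
      parent_pow_level[OF tree, of v n j] unfolding touching_def by blast
  with Suc.IH[OF y(1)] show ?case by auto
qed simp

text \<open>Each passage to the parents shortens a chain of more than \<open>Mstar\<close> steps by one step; this is
  how condition (5) enters.\<close>

lemma touching_parent_shorten:
  assumes "(u, v) \<in> touching P (level G (Suc n)) ^^ Suc k" "k \<ge> Mstar" "u \<in> level G (Suc n)"
  shows "(parent G u, parent G v) \<in> touching P (level G n) ^^ k"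
proof -
  have "Suc k = Suc Mstar + (k - Mstar)" using assms(2) by simp
  with assms(1) have "(u, v) \<in> touching P (level G (Suc n)) ^^ Suc Mstar O
      touching P (level G (Suc n)) ^^ (k - Mstar)"
    by (simp only: relpow_add)
  then obtain y where y: "(u, y) \<in> touching P (level G (Suc n)) ^^ Suc Mstar"
    "(y, v) \<in> touching P (level G (Suc n)) ^^ (k - Mstar)"
    by blast
  have yl: "y \<in> level G (Suc n)" using touching_pow_mem[OF y(1) assms(3)] .
  have "parent G y \<in> level_nbhd G P Mstar (parent G u)"
    using parent_nbhd[OF tverts_level[OF assms(3)]] y(1) level_nbhd_eq[OF assms(3), of P "Mstar + 1"] by auto
  then have "(parent G u, parent G y) \<in> touching P (level G n) ^^ Mstar"
    using level_nbhd_eq[OF parent_level[OF tree assms(3)], of P Mstar] by simp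
  moreover have "(parent G y, parent G v) \<in> touching P (level G n) ^^ (k - Mstar)"
    using touching_parent_pow[where u = y and v = v and n = n and j = 1 and k = "k - Mstar"] y(2) yl by simp
  ultimately have "(parent G u, parent G v) \<in> touching P (level G n) ^^ (Mstar + (k - Mstar))"
    unfolding relpow_add by blast
  then show ?thesis using assms(2) by simp
qed

text \<open>Used with \<open>j = Mstar + 2\<close>: then \<open>Mstar + j\<close> leaves room for
  two chains of \<open>Mstar\<close> steps and two connecting steps.\<close>

lemma touching_ancestor_shorten:
  assumes "(u, v) \<in> touching P (level G (n + j)) ^^ (Mstar + j)" "u \<in> level G (n + j)"
  shows "((parent G ^^ j) u, (parent G ^^ j) v) \<in> touching P (level G n) ^^ Mstar"
  using assms
proof (induction j arbitrary: u v)
  case (Suc j)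
  then have "(parent G u, parent G v) \<in> touching P (level G (n + j)) ^^ (Mstar + j)"
    using touching_parent_shorten[where n = "n + j" and k = "Mstar + j"] by simp
  moreover have "parent G u \<in> level G (n + j)" using Suc.prems(2) parent_level[OF tree] by simp
  ultimately show ?case using Suc.IH by (simp add: funpow_swap1)
qed simp

end

text \<open>The largest of the three summands is at least a third of \<open>d\<close>. The
  truncations by 0 allow for summands that are negative, as the middle one may be in the
  applications.\<close>

lemma powr_three_bound:
  fixes d e p Q :: real
  assumes "d \<le> a + b + c" "0 \<le> d" "0 \<le> e" "0 < p"
    and "e * max 0 a powr p \<le> Q" "e * max 0 b powr p \<le> Q" "e * max 0 c powr p \<le> Q"
  shows "e * d powr p \<le> 3 powr p * Q"
proof -
  obtain s where s: "d \<le> 3 * s" "0 \<le> s" "e * s powr p \<le> Q"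
  proof -
    have "d \<le> 3 * max 0 a \<or> d \<le> 3 * max 0 b \<or> d \<le> 3 * max 0 c" using assms(1,2) by linarith
    with assms that show thesis by (metis max.cobounded1)
  qed
  have "e * d powr p \<le> e * (3 * s) powr p"
    using s assms by (intro mult_left_mono powr_mono2) auto
  also have "\<dots> = 3 powr p * (e * s powr p)" using s by (simp add: powr_mult)
  also have "\<dots> \<le> 3 powr p * Q" using s by (intro mult_left_mono) auto
  finally show ?thesis .
qed

context standing_assumption
begin

section \<open>Decay of the conductances\<close>

lemma nbhd_conductance_eq:
  assumes "w \<in> level G n"
  shows "nbhd_conductance G P M p n m w (level G n) =
    (INF f\<in>{f. (\<forall>x\<in>desc G m w. f x = 1) \<and>
        (\<forall>x\<in>desc_set G m (level G n - {u. (w, u) \<in> touching P (level G n) ^^ M}). f x = 0)}.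
       ennreal (energy G P p (n + m) (level G (n + m)) f))"
  unfolding nbhd_conductance_def conductance_def chain_nbhd_eq[OF assms] desc_set_level[OF tree]
  by (simp add: desc_set_def)

lemma sup_conductance_leI:
  assumes "\<And>n w. 1 \<le> n \<Longrightarrow> w \<in> level G n \<Longrightarrow> nbhd_conductance G P M p n m w (level G n) \<le> c"
  shows "sup_conductance G P M p m \<le> c"
  unfolding sup_conductance_def using assms level_self by (intro SUP_least) blast

lemma nbhd_conductance_le_sup:
  assumes "1 \<le> n" "w \<in> level G n"
  shows "nbhd_conductance G P M p n m w (level G n) \<le> sup_conductance G P M p m"
  unfolding sup_conductance_def using assms
  by (auto intro!: SUP_upper2[of w] simp: level_def)

text \<open>The indicator of the descendants of \<open>w\<close> is admissible, and its energy is
  controlled by their number times the number of neighbours of a cell, uniformly in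
  \<open>w\<close>. This permits real arithmetic with the conductance constants.\<close>

lemma sup_conductance_finite:
  assumes "0 < p" shows "sup_conductance G P M p m < \<infinity>"
proof -
  obtain N where N: "\<And>n w. w \<in> level G n \<Longrightarrow> card {u \<in> level G n. P w \<inter> P u \<noteq> {}} \<le> N"
    using overlap_bound by metis
  obtain \<gamma> where \<gamma>: "0 < \<gamma>" "\<And>w k. w \<in> tverts G \<Longrightarrow> card (desc G k w) \<le> 1 / \<gamma> ^ k"
    using measure_lower by metis
  have "sup_conductance G P M p m \<le> ennreal (1 / \<gamma> ^ m * N)"
  proof (rule sup_conductance_leI)
    fix n w assume w: "w \<in> level G n"
    define D where "D = desc G m w"
    define f :: "'t \<Rightarrow> real" where "f = indicator D"
    let ?X = "level G (n + m)" and ?\<Gamma> = "{u. (w, u) \<in> touching P (level G n) ^^ M}"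
    let ?E = "(?X \<times> ?X) \<inter> cell_edges G P (n + m)"
    \<comment> \<open>Pairs of touching cells that start in \<open>D\<close>. The swapped copy
      covers the other orientation, and having two copies uses up the factor 1/2 of the
      energy.\<close>
    let ?S = "Sigma D (\<lambda>u. {v \<in> ?X. P u \<inter> P v \<noteq> {}})"
    have DX: "D \<subseteq> ?X" "finite D" using desc_subset_level[OF w] in_tree(3)[OF tverts_level[OF w]] by (auto simp: D_def)
    have fS: "finite ?S" using DX in_tree by auto
    have "card ?S = (\<Sum>u\<in>D. card {v \<in> ?X. P u \<inter> P v \<noteq> {}})"
      using DX in_tree by (intro card_SigmaI) auto
    also have "\<dots> \<le> card D * N" using N DX by (intro order_trans[OF sum_bounded_above]) auto
    finally have cS: "card ?S \<le> card D * N" .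
    have "(\<Sum>(u, v)\<in>?E. \<bar>f u - f v\<bar> powr p) \<le> (\<Sum>(u, v)\<in>?E. of_bool ((u, v) \<in> ?S) + of_bool ((u, v) \<in> prod.swap ` ?S))"
    proof (intro sum_mono, clarify)
      fix u v assume uv: "u \<in> ?X" "v \<in> ?X" "(u, v) \<in> cell_edges G P (n + m)"
      then have "P u \<inter> P v \<noteq> {}" "P v \<inter> P u \<noteq> {}" by (auto simp: cell_edges_def)
      with uv have "(u, v) \<in> ?S \<longleftrightarrow> u \<in> D" "(u, v) \<in> prod.swap ` ?S \<longleftrightarrow> v \<in> D" by (auto simp: image_iff)
      then show "\<bar>f u - f v\<bar> powr p \<le> of_bool ((u, v) \<in> ?S) + of_bool ((u, v) \<in> prod.swap ` ?S)"
        by (cases "u \<in> D"; cases "v \<in> D") (simp_all add: f_def)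
    qed
    also have "\<dots> = real (card (?E \<inter> ?S)) + real (card (?E \<inter> prod.swap ` ?S))"
    proof -
      have "(\<Sum>z\<in>?E. of_bool (z \<in> B)) = real (card (?E \<inter> B))" for B
        using sum_of_bool_eq[of ?E "\<lambda>z. z \<in> B"] in_tree by simp
      then show ?thesis unfolding case_prod_unfold prod.collapse sum.distrib by simp
    qed
    also have "\<dots> \<le> real (card ?S) + real (card ?S)"
    proof -
      have "card (?E \<inter> ?S) \<le> card ?S" using fS by (intro card_mono) auto
      moreover have "card (?E \<inter> prod.swap ` ?S) \<le> card (prod.swap ` ?S)" using fS by (intro card_mono) auto
      moreover have "card (prod.swap ` ?S) \<le> card ?S" using fS by (rule card_image_le)
      ultimately show ?thesis by linarith
    qed
    finally have "energy G P p (n + m) ?X f \<le> card ?S" by (simp add: energy_def)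
    also have "\<dots> \<le> real (card D) * N" using cS of_nat_mono by fastforce
    also have "\<dots> \<le> 1 / \<gamma> ^ m * N"
      using \<gamma>(2)[OF tverts_level[OF w], of m] by (intro mult_right_mono) (auto simp: D_def)
    finally have en: "energy G P p (n + m) ?X f \<le> 1 / \<gamma> ^ m * N" .
    have "f x = 0" if x: "x \<in> desc_set G m (level G n - ?\<Gamma>)" for x
    proof -
      obtain v where v: "v \<in> level G n - ?\<Gamma>" "x \<in> desc G m v" using x by (auto simp: desc_set_def)
      have "w \<in> ?\<Gamma>" using touching_pow_mono[where u = w and v = w and n = n and j = 0 and k = M] w by simp
      then have "v \<noteq> w" using v by blast
      then have "x \<notin> D" using ancestor_unique[OF tree, of v x m] ancestor_unique[OF tree, of w x m]
          v w by (auto simp: D_def level_def)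
      then show ?thesis by (simp add: f_def)
    qed
    then have "nbhd_conductance G P M p n m w (level G n) \<le> ennreal (energy G P p (n + m) ?X f)"
      unfolding nbhd_conductance_eq[OF w] by (intro INF_lower) (auto simp: f_def D_def)
    with en show "nbhd_conductance G P M p n m w (level G n) \<le> ennreal (1 / \<gamma> ^ m * N)"
      by (meson ennreal_leI order_trans)
  qed
  then show ?thesis by (rule order_le_less_trans) simp
qed

text \<open>The glued function follows the profile \<open>f\<close> at generation \<open>n + k\<close> and interpolates between
  neighbouring values by the local cutoffs \<open>h u\<close>; taking a maximum of terms that are all of slope
  \<open>\<Delta> u\<close> in \<open>h u\<close> makes its energy at most \<open>\<Sum>\<^sub>u (\<Delta> u)\<^sup>p \<E>(h u)\<close>.\<close>

lemma glue_cutoffs: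
  assumes "0 < p" and w: "w \<in> level G n"
    and f: "\<And>u. u \<in> level G (n + k) \<Longrightarrow> 0 \<le> f u \<and> f u \<le> 1 \<and> 0 \<le> \<Delta> u"
    and f1: "\<And>u. u \<in> desc G k w \<Longrightarrow> f u = 1"
    and f0: "\<And>u u'. u \<in> level G (n + k) \<Longrightarrow> (u, u') \<in> touching P (level G (n + k)) ^^ Mstar \<Longrightarrow>
        (w, (parent G ^^ k) u') \<notin> touching P (level G n) ^^ Mstar \<Longrightarrow> f u = 0"
    and drop: "\<And>u u'. u \<in> level G (n + k) \<Longrightarrow> (u, u') \<in> touching P (level G (n + k)) ^^ Suc Mstar \<Longrightarrow>
        f u - \<Delta> u \<le> f u'"
    and sum: "(\<Sum>u\<in>level G (n + k). \<Delta> u powr p) \<le> \<epsilon>"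
    and h1: "\<And>u x. u \<in> level G (n + k) \<Longrightarrow> x \<in> desc G l u \<Longrightarrow> h u x = 1"
    and h0: "\<And>u x. u \<in> level G (n + k) \<Longrightarrow> x \<in> level G (n + k + l) \<Longrightarrow>
        (u, (parent G ^^ l) x) \<notin> touching P (level G (n + k)) ^^ Mstar \<Longrightarrow> h u x = 0"
    and h: "\<And>u. u \<in> level G (n + k) \<Longrightarrow> energy G P p (n + k + l) (level G (n + k + l)) (h u) \<le> e"
    and "0 \<le> e"
  obtains g where "\<And>x. x \<in> desc G (k + l) w \<Longrightarrow> g x = 1"
    "\<And>x. x \<in> level G (n + k + l) \<Longrightarrow>
        (w, (parent G ^^ (k + l)) x) \<notin> touching P (level G n) ^^ Mstar \<Longrightarrow> g x = 0"
    "energy G P p (n + k + l) (level G (n + k + l)) g \<le> \<epsilon> * e"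
proof -
  define L X where "L = level G (n + k)" and "X = level G (n + k + l)"
  define a where "a = (\<lambda>x. (parent G ^^ l) x)"
  define nb where "nb = (\<lambda>u. {v. (u, v) \<in> touching P L ^^ Mstar})"
  \<comment> \<open>The candidate of \<open>u\<close> has height \<open>f u\<close> where
    \<open>h u\<close> is 1 and \<open>f u - \<Delta> u\<close> where it is 0. The cap at 1 is
    needed because competitors for a conductance may exceed 1, and it guarantees
    \<open>t u x \<le> f u\<close>.\<close>
  define t where "t = (\<lambda>u x. f u - (1 - min 1 (h u x)) * \<Delta> u)"
  define g where "g = (\<lambda>x. Max ((\<lambda>u. t u x) ` nb (a x)))"
  have finL: "finite L" and finX: "finite X" using in_tree by (auto simp: L_def X_def)
  have aL: "a x \<in> L" if "x \<in> X" for x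
    using parent_pow_level[OF tree] that by (auto simp: a_def L_def X_def)
  have nbL: "nb u \<subseteq> L" if "u \<in> L" for u using touching_pow_mem that by (fastforce simp: nb_def)
  have self: "u \<in> nb u" if "u \<in> L" for u
    using touching_pow_mono[where u = u and v = u and n = "n + k" and j = 0 and k = Mstar] that by (simp add: nb_def L_def)
  have fin: "finite (nb u)" if "u \<in> L" for u using nbL[OF that] finL finite_subset by blast
  have g_ge: "t u x \<le> g x" if "x \<in> X" "u \<in> nb (a x)" for u x
    unfolding g_def using fin[OF aL[OF that(1)]] that by (intro Max_ge) auto
  have g_ex: "\<exists>u\<in>nb (a x). g x = t u x" if "x \<in> X" for x
  proof -
    have "g x \<in> (\<lambda>u. t u x) ` nb (a x)"
      unfolding g_def using fin[OF aL[OF that]] self[OF aL[OF that]] by (intro Max_in) auto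
    then show ?thesis by auto
  qed
  have t_le: "t u x \<le> f u" if "u \<in> L" for u x
    using f[of u] that unfolding t_def L_def by (simp add: zero_le_mult_iff)
  have t_self: "t (a x) x = f (a x)" if "x \<in> X" for x
  proof -
    have "x \<in> desc G l (a x)" using mem_desc_ancestor[OF tree, of x "n + k" l] that by (simp add: a_def X_def)
    then have "h (a x) x = 1" using h1 aL[OF that] by (simp add: L_def)
    then show ?thesis by (simp add: t_def)
  qed
  have g_lower: "f (a x) \<le> g x" if "x \<in> X" for x
    using g_ge[OF that self[OF aL[OF that]]] t_self[OF that] by simp
  \<comment> \<open>The cell \<open>u\<close> attaining the maximum at \<open>x\<close> is tested at
    \<open>y\<close>. If it no longer competes there, then \<open>h u y = 0\<close>, and its
    candidate has sunk to \<open>f u - \<Delta> u\<close>, which lies below \<open>f (a y)\<close>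
    because \<open>u\<close> and \<open>a y\<close> are \<open>Suc Mstar\<close> steps
    apart.\<close>
  have step: "\<exists>u\<in>L. g x - g y \<le> \<Delta> u * \<bar>h u x - h u y\<bar>" if xy: "x \<in> X" "y \<in> X" "P x \<inter> P y \<noteq> {}" for x y
  proof -
    obtain u where u: "u \<in> nb (a x)" "g x = t u x" using g_ex[OF xy(1)] by blast
    have uL: "u \<in> L" using u(1) nbL aL[OF xy(1)] by blast
    have \<Delta>: "0 \<le> \<Delta> u" using f uL by (simp add: L_def)
    have "t u y \<le> g y"
    proof (cases "u \<in> nb (a y)")
      case True
      then show ?thesis using g_ge[OF xy(2)] by blast
    next
      case False
      then have "(u, a y) \<notin> touching P L ^^ Mstar" using touching_sym by (fastforce simp: nb_def)
      then have "h u y = 0" using h0[of u y] uL xy(2) by (simp add: L_def X_def a_def)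
      then have "t u y = f u - \<Delta> u" by (simp add: t_def)
      also have "\<dots> \<le> f (a y)"
      proof (rule drop)
        have "(u, a x) \<in> touching P L ^^ Mstar" using u(1) touching_sym by (fastforce simp: nb_def)
        moreover have "(a x, a y) \<in> touching P L"
          using touching_parent_pow[where n = "n + k" and j = l and k = 1 and u = x and v = y] xy
          by (simp add: touching_def L_def X_def a_def)
        ultimately show "(u, a y) \<in> touching P (level G (n + k)) ^^ Suc Mstar" by (auto simp: L_def)
      qed (use uL in \<open>simp add: L_def\<close>)
      also have "\<dots> \<le> g y" using g_lower[OF xy(2)] .
      finally show ?thesis .
    qed
    then have "g x - g y \<le> t u x - t u y" using u(2) by simp
    also have "\<dots> = \<Delta> u * (min 1 (h u x) - min 1 (h u y))" by (simp add: t_def algebra_simps)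
    also have "\<dots> \<le> \<Delta> u * \<bar>h u x - h u y\<bar>" using \<Delta> by (intro mult_left_mono) auto
    finally show ?thesis using uL by blast
  qed
  have edge: "\<bar>g x - g y\<bar> powr p \<le> (\<Sum>u\<in>L. \<Delta> u powr p * \<bar>h u x - h u y\<bar> powr p)"
    if xy: "x \<in> X" "y \<in> X" "P x \<inter> P y \<noteq> {}" for x y
  proof -
    obtain u where u: "u \<in> L" "\<bar>g x - g y\<bar> \<le> \<Delta> u * \<bar>h u x - h u y\<bar>"
    proof (cases "g y \<le> g x")
      case True
      with step[OF xy] that show thesis by auto
    next
      case False
      have "P y \<inter> P x \<noteq> {}" using xy(3) by blast
      from step[OF xy(2,1) this] False that show thesis by (auto simp: abs_minus_commute)
    qed
    have "\<bar>g x - g y\<bar> powr p \<le> (\<Delta> u * \<bar>h u x - h u y\<bar>) powr p"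
      using u assms(1) by (intro powr_mono2) auto
    also have "\<dots> = \<Delta> u powr p * \<bar>h u x - h u y\<bar> powr p" using f u(1) by (simp add: powr_mult L_def)
    also have "\<dots> \<le> (\<Sum>u\<in>L. \<Delta> u powr p * \<bar>h u x - h u y\<bar> powr p)"
      using u(1) finL by (intro member_le_sum) auto
    finally show ?thesis .
  qed
  have "energy G P p (n + k + l) X g
      \<le> 1 / 2 * (\<Sum>(x, y)\<in>(X \<times> X) \<inter> cell_edges G P (n + k + l). \<Sum>u\<in>L. \<Delta> u powr p * \<bar>h u x - h u y\<bar> powr p)"
    unfolding energy_def using edge by (intro mult_left_mono sum_mono) (auto simp: cell_edges_def)
  also have "\<dots> = (\<Sum>u\<in>L. \<Delta> u powr p * energy G P p (n + k + l) X (h u))"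
    unfolding energy_def case_prod_unfold
    by (subst sum.swap) (simp add: sum_distrib_left mult_ac)
  also have "\<dots> \<le> (\<Sum>u\<in>L. \<Delta> u powr p * e)"
    using h by (intro sum_mono mult_left_mono) (auto simp: L_def X_def)
  also have "\<dots> \<le> \<epsilon> * e"
    using sum assms(11) by (simp add: sum_distrib_right[symmetric] mult_right_mono L_def)
  finally have "energy G P p (n + k + l) X g \<le> \<epsilon> * e" .
  moreover have "g x = 1" if x: "x \<in> desc G (k + l) w" for x
  proof -
    obtain u where u: "u \<in> desc G k w" "x \<in> desc G l u"
      using x desc_add[OF tree, of k l w] by (auto simp: desc_set_def)
    have uL: "u \<in> L" using desc_subset_level[OF w] u(1) by (auto simp: L_def)
    then have xX: "x \<in> X" using desc_subset_level[of u "n + k" l] u(2) by (auto simp: L_def X_def)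
    have "a x = u" using ancestor_unique[OF tree _ u(2)] uL by (simp add: a_def L_def level_def)
    with g_lower[OF xX] f1[OF u(1)] have "1 \<le> g x" by simp
    moreover obtain u' where u': "u' \<in> nb (a x)" "g x = t u' x" using g_ex[OF xX] by blast
    then have "u' \<in> L" using nbL aL[OF xX] by blast
    then have "g x \<le> 1" using t_le[of u' x] f[of u'] u'(2) by (simp add: L_def)
    ultimately show ?thesis by simp
  qed
  moreover have "g x = 0" if x: "x \<in> X" "(w, (parent G ^^ (k + l)) x) \<notin> touching P (level G n) ^^ Mstar" for x
  proof -
    have eq: "(parent G ^^ k) (a x) = (parent G ^^ (k + l)) x" by (simp add: a_def funpow_add)
    \<comment> \<open>Outside the permitted region every competing \<open>f u\<close> vanishes, not
      just \<open>f (a x)\<close>: this is the margin of \<open>Mstar\<close> steps demanded in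
      \<open>f0\<close>.\<close>
    have *: "f u = 0" if "u \<in> nb (a x)" for u
    proof (rule f0)
      show "(u, a x) \<in> touching P (level G (n + k)) ^^ Mstar"
        using that touching_sym by (fastforce simp: nb_def L_def)
    qed (use that nbL aL[OF x(1)] x(2) eq in \<open>auto simp: L_def\<close>)
    obtain u where u: "u \<in> nb (a x)" "g x = t u x" using g_ex[OF x(1)] by blast
    then have "u \<in> L" using nbL aL[OF x(1)] by blast
    from t_le[OF this, of x] *[OF u(1)] u(2) have "g x \<le> 0" by simp
    moreover have "0 \<le> g x" using g_lower[OF x(1)] *[OF self[OF aL[OF x(1)]]] by simp
    ultimately show ?thesis by simp
  qed
  ultimately show thesis unfolding X_def by (intro that[of g]) blast+
qed

text \<open>The function \<open>f\<close> vanishes so early that enlarging its support by \<open>Mstar\<close> steps, as the gluing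
  does, stays inside the descendants of \<open>\<Gamma>\<^sub>M(w)\<close>.\<close>

definition has_cutoff :: "real \<Rightarrow> real \<Rightarrow> nat \<Rightarrow> nat \<Rightarrow> 't \<Rightarrow> bool" where
  "has_cutoff p \<epsilon> k n w \<longleftrightarrow> (\<exists>f \<Delta>.
       (\<forall>u\<in>level G (n + k). 0 \<le> f u \<and> f u \<le> 1 \<and> 0 \<le> \<Delta> u) \<and> (\<forall>u\<in>desc G k w. f u = 1) \<and>
       (\<forall>u\<in>level G (n + k). \<forall>u'. (u, u') \<in> touching P (level G (n + k)) ^^ Mstar \<longrightarrow>
          (w, (parent G ^^ k) u') \<notin> touching P (level G n) ^^ Mstar \<longrightarrow> f u = 0) \<and>
       (\<forall>u\<in>level G (n + k). \<forall>u'. (u, u') \<in> touching P (level G (n + k)) ^^ Suc Mstar \<longrightarrow>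
          f u - \<Delta> u \<le> f u') \<and>
       (\<Sum>u\<in>level G (n + k). \<Delta> u powr p) \<le> \<epsilon>)"

text \<open>The cutoff at generation k supplies the slopes, and competitors at scale l supply the
  local profiles. As infima are only approximated, the profiles have slack
  \<open>\<delta> / \<epsilon>\<close>, which the gluing factor \<epsilon> turns into
  \<delta>.\<close>

lemma sup_conductance_decay:
  assumes "0 < p" "0 < \<epsilon>"
    and cutoff: "\<And>n w. 1 \<le> n \<Longrightarrow> w \<in> level G n \<Longrightarrow> has_cutoff p \<epsilon> k n w"
  shows "sup_conductance G P Mstar p (k + l) \<le> ennreal \<epsilon> * sup_conductance G P Mstar p l"
proof (rule sup_conductance_leI, rule ennreal_le_epsilon)
  fix n w and \<delta> :: real
  assume n: "1 \<le> n" and w: "w \<in> level G n" and \<delta>: "0 < \<delta>"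
  define e where "e = enn2real (sup_conductance G P Mstar p l)"
  have e: "0 \<le> e" "sup_conductance G P Mstar p l = ennreal e"
    using sup_conductance_finite[OF assms(1), of Mstar l] by (auto simp: e_def less_top)
  let ?L = "level G (n + k)" and ?X = "level G (n + k + l)"
  have "\<exists>h. (\<forall>x\<in>desc G l u. h x = 1) \<and>
      (\<forall>x\<in>?X. (u, (parent G ^^ l) x) \<notin> touching P ?L ^^ Mstar \<longrightarrow> h x = 0) \<and>
      energy G P p (n + k + l) ?X h \<le> e + \<delta> / \<epsilon>" if u: "u \<in> ?L" for u
  proof -
    have "nbhd_conductance G P Mstar p (n + k) l u ?L \<le> ennreal e"
      using nbhd_conductance_le_sup[of "n + k" u Mstar p l] u n e by simp
    also have "\<dots> < ennreal (e + \<delta> / \<epsilon>)" using e \<delta> assms(2) by (simp add: ennreal_less_iff)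
    finally obtain h where h: "\<forall>x\<in>desc G l u. h x = 1"
      "\<forall>x\<in>desc_set G l (?L - {v. (u, v) \<in> touching P ?L ^^ Mstar}). h x = 0"
      "ennreal (energy G P p (n + k + l) ?X h) < ennreal (e + \<delta> / \<epsilon>)"
      unfolding nbhd_conductance_eq[OF u] INF_less_iff by auto
    have "x \<in> desc_set G l (?L - {v. (u, v) \<in> touching P ?L ^^ Mstar})"
      if "x \<in> ?X" "(u, (parent G ^^ l) x) \<notin> touching P ?L ^^ Mstar" for x
      using mem_desc_ancestor[OF tree, of x "n + k" l] parent_pow_level[OF tree, of x "n + k" l] that
      by (auto simp: desc_set_def)
    moreover have "energy G P p (n + k + l) ?X h \<le> e + \<delta> / \<epsilon>"
      using h(3) energy_nonneg[of G P p "n + k + l" ?X h]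
      by (simp only: ennreal_less_iff less_imp_le)
    ultimately show ?thesis using h by blast
  qed
  then obtain h where h: "\<And>u. u \<in> ?L \<Longrightarrow> (\<forall>x\<in>desc G l u. h u x = 1) \<and>
      (\<forall>x\<in>?X. (u, (parent G ^^ l) x) \<notin> touching P ?L ^^ Mstar \<longrightarrow> h u x = 0) \<and>
      energy G P p (n + k + l) ?X (h u) \<le> e + \<delta> / \<epsilon>" by metis
  have "0 \<le> e + \<delta> / \<epsilon>" using e \<delta> assms(2) by simp
  obtain f \<Delta> where f: "\<forall>u\<in>level G (n + k). 0 \<le> f u \<and> f u \<le> 1 \<and> 0 \<le> \<Delta> u" "\<forall>u\<in>desc G k w. f u = 1"
      "\<forall>u\<in>level G (n + k). \<forall>u'. (u, u') \<in> touching P (level G (n + k)) ^^ Mstar \<longrightarrow>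
          (w, (parent G ^^ k) u') \<notin> touching P (level G n) ^^ Mstar \<longrightarrow> f u = 0"
      "\<forall>u\<in>level G (n + k). \<forall>u'. (u, u') \<in> touching P (level G (n + k)) ^^ Suc Mstar \<longrightarrow>
          f u - \<Delta> u \<le> f u'"
      "(\<Sum>u\<in>level G (n + k). \<Delta> u powr p) \<le> \<epsilon>"
    using cutoff[OF n w] unfolding has_cutoff_def by (elim exE conjE)
  obtain g where g: "\<And>x. x \<in> desc G (k + l) w \<Longrightarrow> g x = 1"
    "\<And>x. x \<in> ?X \<Longrightarrow> (w, (parent G ^^ (k + l)) x) \<notin> touching P (level G n) ^^ Mstar \<Longrightarrow> g x = 0"
    "energy G P p (n + k + l) ?X g \<le> \<epsilon> * (e + \<delta> / \<epsilon>)"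
    by (rule glue_cutoffs[OF assms(1) w, of k f \<Delta> \<epsilon> l h "e + \<delta> / \<epsilon>"])
      (use f h \<open>0 \<le> e + \<delta> / \<epsilon>\<close> in \<open>blast+\<close>)
  have "g x = 0" if x: "x \<in> desc_set G (k + l) (level G n - {u. (w, u) \<in> touching P (level G n) ^^ Mstar})" for x
  proof -
    obtain v where v: "v \<in> level G n" "(w, v) \<notin> touching P (level G n) ^^ Mstar" "x \<in> desc G (k + l) v"
      using x by (auto simp: desc_set_def)
    then have "(parent G ^^ (k + l)) x = v" using ancestor_unique[OF tree tverts_level] by blast
    moreover have "x \<in> ?X" using desc_subset_level[OF v(1)] v(3) by (auto simp: add.assoc)
    ultimately show ?thesis using g(2) v(2) by blast
  qed
  with g(1) have "nbhd_conductance G P Mstar p n (k + l) w (level G n)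
      \<le> ennreal (energy G P p (n + (k + l)) (level G (n + (k + l))) g)"
    unfolding nbhd_conductance_eq[OF w] by (intro INF_lower) auto
  also have "\<dots> \<le> ennreal (\<epsilon> * e + \<delta>)"
    using g(3) assms(2) by (intro ennreal_leI) (simp add: algebra_simps)
  also have "\<dots> = ennreal \<epsilon> * sup_conductance G P Mstar p l + ennreal \<delta>"
    using e assms(2) \<delta> by (simp add: ennreal_mult' ennreal_plus)
  finally show "nbhd_conductance G P Mstar p n (k + l) w (level G n)
      \<le> ennreal \<epsilon> * sup_conductance G P Mstar p l + ennreal \<delta>" .
qed

section \<open>Oscillation estimate\<close>

lemma energy_desc_mono:
  assumes "w \<in> tverts G" "u \<in> desc G k w"
  shows "energy G P p n (desc G l u) f \<le> energy G P p n (desc G (k + l) w) f"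
proof (rule energy_mono_set)
  show "desc G l u \<subseteq> desc G (k + l) w" using assms(2) by (auto simp: desc_add[OF tree] desc_set_def)
qed (rule in_tree(3)[OF assms(1)])

text \<open>Here \<open>e m\<close> stands for the conductance constant at scale \<open>m\<close>. Descending \<open>k\<close> generations
  costs a factor of at most three in the oscillation, which the decay of \<open>e\<close> compensates exactly.\<close>

lemma oscillation_bound:
  fixes e :: "nat \<Rightarrow> real"
  assumes "0 < p" "1 \<le> k" "0 < c" and e0: "\<And>m. 0 \<le> e m"
    and decay: "\<And>l. 3 powr p * e (k + l) \<le> e l"
    and gap: "\<And>l w u v f. 1 \<le> l \<Longrightarrow> w \<in> tverts G \<Longrightarrow> u \<in> desc G k w \<Longrightarrow> v \<in> desc G k w \<Longrightarrow> u \<noteq> v \<Longrightarrow>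
       (\<And>x. x \<in> desc G l u \<Longrightarrow> f x = 1) \<Longrightarrow> (\<And>x. x \<in> desc G l v \<Longrightarrow> f x = 0) \<Longrightarrow>
       e l \<le> c * energy G P p (vheight G w + (k + l)) (desc G (k + l) w) f"
  obtains B where "0 \<le> B" "\<And>m w f x y. w \<in> tverts G \<Longrightarrow> x \<in> desc G m w \<Longrightarrow> y \<in> desc G m w \<Longrightarrow>
       e m * \<bar>f x - f y\<bar> powr p \<le> B * energy G P p (vheight G w + m) (desc G m w) f"
proof -
  obtain \<gamma> where \<gamma>: "0 < \<gamma>" "\<gamma> < 1" "\<And>w k. w \<in> tverts G \<Longrightarrow> card (desc G k w) \<le> 1 / \<gamma> ^ k"
    using measure_lower by metis
  define Em where "Em = Max (e ` {..k})"
  \<comment> \<open>The entry \<open>c\<close> serves the gap between two cells; the other entry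
    serves the scales up to \<open>k\<close>, where a cell has at most \<gamma>^-k descendants and
    chains through them suffice.\<close>
  define B where "B = max c (Em * ((1 / \<gamma> ^ k)\<^sup>2) powr p)"
  have Em: "e m \<le> Em" if "m \<le> k" for m unfolding Em_def using that by (intro Max_ge) auto
  then have Em0: "0 \<le> Em" using e0[of 0] by force
  have B: "0 \<le> B" "c \<le> B" using assms(3) by (auto simp: B_def)
  have gap_powr: "e l * max 0 (f s - f t) powr p \<le> B * energy G P p (vheight G w + (k + l)) (desc G (k + l) w) f"
    if l: "1 \<le> l" "w \<in> tverts G" "u \<in> desc G k w" "v \<in> desc G k w"
      and s: "s \<in> desc G l u" "\<And>x. x \<in> desc G l u \<Longrightarrow> f s \<le> f x"
      and t: "t \<in> desc G l v" "\<And>x. x \<in> desc G l v \<Longrightarrow> f x \<le> f t" for l w u v f s t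
  proof (cases "f t < f s")
    case True
    \<comment> \<open>Since \<open>s\<close> is a minimum over one cell and \<open>t\<close> a
      maximum over the other, clamping between \<open>f t\<close> and \<open>f s\<close> gives 1 on
      the first and 0 on the second.\<close>
    let ?T = "f s - f t" and ?n = "vheight G w + (k + l)"
    let ?g = "\<lambda>x. max 0 (min 1 ((f x - f t) / ?T))"
    have "u \<noteq> v" using True s t by force
    then have "e l \<le> c * energy G P p ?n (desc G (k + l) w) ?g"
    proof (intro gap[OF l])
      show "?g x = 1" if "x \<in> desc G l u" for x using s(2)[OF that] True by (simp add: min_absorb1)
      show "?g x = 0" if "x \<in> desc G l v" for x
      proof -
        have "(f x - f t) / ?T \<le> 0" using t(2)[OF that] True by (simp add: divide_nonpos_pos)
        then show ?thesis by simp
      qed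
    qed
    also have "\<dots> \<le> c * (energy G P p ?n (desc G (k + l) w) f / ?T powr p)"
      using energy_clamp_scale[of ?T p] True assms(1,3) by (intro mult_left_mono) auto
    finally have "e l * ?T powr p \<le> c * energy G P p ?n (desc G (k + l) w) f"
      using True by (simp add: field_simps)
    also have "\<dots> \<le> B * energy G P p ?n (desc G (k + l) w) f"
      using B energy_nonneg by (intro mult_right_mono) auto
    finally show ?thesis using True by simp
  next
    case False
    then show ?thesis
      using mult_nonneg_nonneg[OF B(1) energy_nonneg] by (simp add: max_absorb1)
  qed
  have main: "e m * \<bar>f x - f y\<bar> powr p \<le> B * energy G P p (vheight G w + m) (desc G m w) f"
    if "w \<in> tverts G" "x \<in> desc G m w" "y \<in> desc G m w" for m w f x y
    using that
  proof (induction m arbitrary: w x y rule: less_induct)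
    case (less m)
    let ?A = "desc G m w" and ?n = "vheight G w + m"
    show ?case
    proof (cases "m \<le> k")
      case True
      have "real (card ?A) \<le> 1 / \<gamma> ^ m" using \<gamma> less.prems by blast
      also have "\<dots> \<le> 1 / \<gamma> ^ k"
        using \<gamma>(1,2) True by (intro divide_left_mono power_decreasing) auto
      finally have "real ((card ?A)\<^sup>2) \<le> (1 / \<gamma> ^ k)\<^sup>2" unfolding of_nat_power by (intro power_mono) auto
      then have pw: "real ((card ?A)\<^sup>2) powr p \<le> ((1 / \<gamma> ^ k)\<^sup>2) powr p"
        using assms(1) by (intro powr_mono2) auto
      have "\<bar>f x - f y\<bar> powr p \<le> real ((card ?A)\<^sup>2) powr p * energy G P p ?n ?A f"
        using desc_subset_level[OF level_self[OF less.prems(1)]] desc_chain[OF less.prems] in_tree(3)[OF less.prems(1)] assms(1)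
        by (intro connected_le_energy) auto
      also have "\<dots> \<le> ((1 / \<gamma> ^ k)\<^sup>2) powr p * energy G P p ?n ?A f"
        using pw energy_nonneg by (intro mult_right_mono) auto
      finally have "e m * \<bar>f x - f y\<bar> powr p \<le> Em * (((1 / \<gamma> ^ k)\<^sup>2) powr p * energy G P p ?n ?A f)"
        using Em[OF True] Em0 e0[of m] by (intro mult_mono) auto
      also have "\<dots> \<le> B * energy G P p ?n ?A f"
        unfolding mult.assoc[symmetric] using energy_nonneg by (intro mult_right_mono) (auto simp: B_def)
      finally show ?thesis .
    next
      case False
      define l where "l = m - k"
      have l: "1 \<le> l" "m = k + l" "l < m" using False assms(2) by (auto simp: l_def)
      let ?Q = "B * energy G P p ?n ?A f"
      have one: "e l * (f a - f b) powr p \<le> ?Q" if ab: "a \<in> ?A" "b \<in> ?A" "f b \<le> f a"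
          and uv: "u \<in> desc G k w" "a \<in> desc G l u" "b \<in> desc G l u" for a b u
      proof -
        have u: "u \<in> tverts G" "vheight G u = vheight G w + k"
          using desc_subset_level[OF level_self[OF less.prems(1)], of k] uv(1) by (auto simp: level_def)
        have "e l * \<bar>f a - f b\<bar> powr p \<le> B * energy G P p (vheight G u + l) (desc G l u) f"
          using less.IH[OF l(3) u(1) uv(2,3)] .
        also have "\<dots> \<le> ?Q"
          using energy_desc_mono[OF less.prems(1) uv(1), of p ?n l f] B u l(2)
          by (intro mult_left_mono) (auto simp: add.assoc)
        finally show ?thesis using ab by simp
      qed
      have ordered: "e m * (f a - f b) powr p \<le> ?Q" if ab: "a \<in> ?A" "b \<in> ?A" "f b \<le> f a" for a b
      proof -
        obtain u v where uv: "u \<in> desc G k w" "a \<in> desc G l u" "v \<in> desc G k w" "b \<in> desc G l v"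
          using ab(1,2) unfolding l(2) desc_add[OF tree] desc_set_def by blast
        have tv: "u \<in> tverts G" "v \<in> tverts G" using uv desc_tverts[OF less.prems(1)] by auto
        have sub: "desc G l u \<subseteq> ?A" "desc G l v \<subseteq> ?A"
          using uv unfolding l(2) desc_add[OF tree] desc_set_def by blast+
        obtain s where s: "s \<in> desc G l u" "\<And>x. x \<in> desc G l u \<Longrightarrow> f s \<le> f x"
          using obtains_MIN[OF in_tree(3)[OF tv(1)] desc_nonempty[OF tv(1)], of l f]
          by (metis Min_le finite_imageI image_eqI in_tree(3) tv(1))
        obtain t where t: "t \<in> desc G l v" "\<And>x. x \<in> desc G l v \<Longrightarrow> f x \<le> f t"
          using obtains_MAX[OF in_tree(3)[OF tv(2)] desc_nonempty[OF tv(2)], of l f]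
          by (metis Max_ge finite_imageI image_eqI in_tree(3) tv(2))
        \<comment> \<open>The outer two differences stay inside one cell of generation k and fall
          under the induction hypothesis at scale \<open>l\<close>; the middle one is the gap. All
          three have the same bound \<open>?Q\<close>, so the only loss is 3^p, which the decay from
          \<open>l\<close> to \<open>k + l\<close> removes.\<close>
        have "e l * (f a - f b) powr p \<le> 3 powr p * ?Q"
        proof (rule powr_three_bound)
          show "f a - f b \<le> (f a - f s) + (f s - f t) + (f t - f b)" by simp
          show "e l * max 0 (f a - f s) powr p \<le> ?Q"
            using one[of a s u] s uv sub by (simp add: subset_iff)
          show "e l * max 0 (f t - f b) powr p \<le> ?Q"
            using one[of t b v] t uv sub by (simp add: subset_iff)
          show "e l * max 0 (f s - f t) powr p \<le> ?Q"
            using gap_powr[OF l(1) less.prems(1) uv(1,3) s t] l(2) by simp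
        qed (use ab e0 assms(1) in auto)
        moreover have "3 powr p * (e m * (f a - f b) powr p) \<le> e l * (f a - f b) powr p"
          using mult_right_mono[OF decay[of l], of "(f a - f b) powr p"] l(2) by (simp add: mult.assoc)
        ultimately have "3 powr p * (e m * (f a - f b) powr p) \<le> 3 powr p * ?Q" by linarith
        then show ?thesis by simp
      qed
      show ?thesis
        using ordered[of x y] ordered[of y x] less.prems by (cases "f y \<le> f x") (auto simp: abs_real_def)
    qed
  qed
  show thesis using that[OF B(1) main] .
qed

section \<open>Conductive homogeneity\<close>

text \<open>Some value over \<open>w\<close> is at least its mean and some value over
  \<open>v\<close> at most its mean. They are joined through two touching descendants
  \<open>s\<close> and \<open>t\<close> at a common point of the cells: two oscillations, paid by
  \<open>B\<close>, and one edge, paid by \<open>Em\<close>.\<close>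

lemma mean_difference_bound:
  fixes e :: "nat \<Rightarrow> real"
  assumes "0 < p" and e0: "0 \<le> e m" "e m \<le> Em" and "0 \<le> B"
    and osc: "\<And>w f x y. w \<in> tverts G \<Longrightarrow> x \<in> desc G m w \<Longrightarrow> y \<in> desc G m w \<Longrightarrow>
       e m * \<bar>f x - f y\<bar> powr p \<le> B * energy G P p (vheight G w + m) (desc G m w) f"
    and wv: "(w, v) \<in> cell_edges G P n"
  shows "e m * \<bar>cell_mean P \<mu> (desc G m w) f - cell_mean P \<mu> (desc G m v) f\<bar> powr p
    \<le> 3 powr p * (max B Em * energy G P p (n + m) (desc G m w \<union> desc G m v) f)"
proof -
  have *: "e m * (cell_mean P \<mu> (desc G m w) f - cell_mean P \<mu> (desc G m v) f) powr p
    \<le> 3 powr p * (max B Em * energy G P p (n + m) (desc G m w \<union> desc G m v) f)"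
    if wv: "(w, v) \<in> cell_edges G P n"
      and le: "cell_mean P \<mu> (desc G m v) f \<le> cell_mean P \<mu> (desc G m w) f" for w v
  proof -
    let ?A = "desc G m w \<union> desc G m v" and ?n = "n + m"
    let ?Q = "max B Em * energy G P p ?n ?A f"
    have lv: "w \<in> level G n" "v \<in> level G n" "P w \<inter> P v \<noteq> {}" using wv by (auto simp: cell_edges_def)
    then have tv: "w \<in> tverts G" "v \<in> tverts G" "vheight G w = n" "vheight G v = n" by (auto simp: level_def)
    have fin: "finite ?A" using in_tree(3) tv by simp
    obtain a where a: "a \<in> desc G m w" "cell_mean P \<mu> (desc G m w) f \<le> f a"
    proof (rule ccontr)
      assume "\<not> thesis"
      with that have lt: "\<And>x. x \<in> desc G m w \<Longrightarrow> f x < cell_mean P \<mu> (desc G m w) f" by force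
      have fd: "finite (f ` desc G m w)" "f ` desc G m w \<noteq> {}" using in_tree(3) desc_nonempty tv by auto
      have "cell_mean P \<mu> (desc G m w) f \<le> Max (f ` desc G m w)"
        by (rule cell_mean_between(2)[OF tv(1), of _ "Min (f ` desc G m w)"]) (use fd in auto)
      then show False using Max_in[OF fd] lt by force
    qed
    obtain b where b: "b \<in> desc G m v" "f b \<le> cell_mean P \<mu> (desc G m v) f"
    proof (rule ccontr)
      assume "\<not> thesis"
      with that have lt: "\<And>x. x \<in> desc G m v \<Longrightarrow> cell_mean P \<mu> (desc G m v) f < f x" by force
      have fd: "finite (f ` desc G m v)" "f ` desc G m v \<noteq> {}" using in_tree(3) desc_nonempty tv by auto
      have "Min (f ` desc G m v) \<le> cell_mean P \<mu> (desc G m v) f"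
        by (rule cell_mean_between(1)[OF tv(2), of _ _ _ "Max (f ` desc G m v)"]) (use fd in auto)
      then show False using Min_in[OF fd] lt by force
    qed
    obtain z where "z \<in> P w" "z \<in> P v" using lv by blast
    then obtain s t where st: "s \<in> desc G m w" "t \<in> desc G m v" "z \<in> P s" "z \<in> P t"
      using P_desc[OF tv(1), of m] P_desc[OF tv(2), of m] by blast
    have Q: "B * energy G P p ?n D f \<le> ?Q" if "D \<subseteq> ?A" for D
      using energy_mono_set[OF that fin, of G P p ?n f] energy_nonneg[of G P p ?n D f] assms(4)
      by (intro mult_mono) auto
    have osc': "e m * max 0 (f x - f y) powr p \<le> ?Q"
      if "x \<in> desc G m u" "y \<in> desc G m u" "u = w \<or> u = v" for x y u
    proof -
      have "max 0 (f x - f y) powr p \<le> \<bar>f x - f y\<bar> powr p" using assms(1) by (intro powr_mono2) auto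
      then have "e m * max 0 (f x - f y) powr p \<le> e m * \<bar>f x - f y\<bar> powr p"
        using e0 by (intro mult_left_mono) auto
      also have "\<dots> \<le> B * energy G P p ?n (desc G m u) f"
        using osc[OF _ that(1,2), of f] that(3) tv by auto
      also have "\<dots> \<le> ?Q" using that by (intro Q) auto
      finally show ?thesis .
    qed
    have edge: "e m * max 0 (f s - f t) powr p \<le> ?Q"
    proof -
      have "max 0 (f s - f t) powr p \<le> \<bar>f s - f t\<bar> powr p" using assms(1) by (intro powr_mono2) auto
      also have "\<dots> \<le> energy G P p ?n ?A f"
        using st fin desc_subset_level lv by (intro edge_le_energy) (auto simp: touching_def)
      finally show ?thesis using e0 assms(4) by (intro mult_mono) auto
    qed
    let ?d = "cell_mean P \<mu> (desc G m w) f - cell_mean P \<mu> (desc G m v) f"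
    have "?d \<le> (f a - f s) + (f s - f t) + (f t - f b)" using a b by simp
    then show ?thesis
      by (rule powr_three_bound)
        (use le assms(1) e0 osc'[OF a(1) st(1)] osc'[OF st(2) b(1)] edge in auto)
  qed
  have vw: "(v, w) \<in> cell_edges G P n" using wv by (auto simp: cell_edges_def)
  show ?thesis
    using *[OF wv] *[OF vw]
    by (cases "cell_mean P \<mu> (desc G m v) f \<le> cell_mean P \<mu> (desc G m w) f")
      (auto simp: abs_real_def Un_commute)
qed

lemma sup_conductance_real:
  assumes "0 < p"
  obtains e where "\<And>m. 0 \<le> e m" "\<And>m. sup_conductance G P M p m = ennreal (e m)"
proof (rule that[of "\<lambda>m. enn2real (sup_conductance G P M p m)"])
  show "sup_conductance G P M p m = ennreal (enn2real (sup_conductance G P M p m))" for m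
    using sup_conductance_finite[OF assms, of M m] by (simp add: less_top)
qed simp

lemma conductance_desc_le_energy:
  assumes "\<And>x. x \<in> desc G m u \<Longrightarrow> f x = 1" "\<And>x. x \<in> desc G m v \<Longrightarrow> f x = 0"
  shows "conductance G P p (vheight G w + k) m {u} {v} (desc G k w)
    \<le> ennreal (energy G P p (vheight G w + (k + m)) (desc G (k + m) w) f)"
  unfolding conductance_def desc_add[OF tree]
  using assms by (auto intro!: INF_lower2[of f] simp: desc_set_def add.assoc)

theorem local_conductance_imp_homogeneous:
  assumes "0 < p" "1 \<le> k"
    and decay: "\<And>l. sup_conductance G P Mstar p (k + l) \<le> ennreal (1 / 3 powr p) * sup_conductance G P Mstar p l"
    and "0 < c" and local: "\<And>m w u v. 1 \<le> m \<Longrightarrow> w \<in> tverts G \<Longrightarrow> u \<in> desc G k w \<Longrightarrow> v \<in> desc G k w \<Longrightarrow> u \<noteq> v \<Longrightarrow>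
       sup_conductance G P Mstar p m
         \<le> ennreal c * conductance G P p (vheight G w + k) m {u} {v} (desc G k w)"
  shows "conductively_homogeneous G P \<mu> Mstar p"
proof -
  obtain e where e: "\<And>m. 0 \<le> e m" "\<And>m. sup_conductance G P Mstar p m = ennreal (e m)"
    using sup_conductance_real[OF assms(1), of Mstar] by blast
  have dec: "3 powr p * e (k + l) \<le> e l" for l
    using decay[of l] e by (simp add: ennreal_mult'[symmetric] field_simps)
  have "e l \<le> c * energy G P p (vheight G w + (k + l)) (desc G (k + l) w) f"
    if "1 \<le> l" "w \<in> tverts G" "u \<in> desc G k w" "v \<in> desc G k w" "u \<noteq> v"
      "\<And>x. x \<in> desc G l u \<Longrightarrow> f x = 1" "\<And>x. x \<in> desc G l v \<Longrightarrow> f x = 0" for l w u v f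
  proof -
    have "ennreal (e l) \<le> ennreal c * ennreal (energy G P p (vheight G w + (k + l)) (desc G (k + l) w) f)"
      using order_trans[OF local[OF that(1-5)] mult_left_mono[OF
          conductance_desc_le_energy[OF that(6,7), where p = p and w = w and k = k] zero_le]] e(2) by simp
    then show ?thesis using assms(4) energy_nonneg[of G P p]
      by (simp add: ennreal_mult'[symmetric])
  qed
  note gap = this
  obtain B where B: "0 \<le> B"
    "\<And>m w f x y. w \<in> tverts G \<Longrightarrow> x \<in> desc G m w \<Longrightarrow> y \<in> desc G m w \<Longrightarrow>
       e m * \<bar>f x - f y\<bar> powr p \<le> B * energy G P p (vheight G w + m) (desc G m w) f"
  proof (rule oscillation_bound[where e = e, OF assms(1,2,4) e(1) dec])
    fix l w u v and f :: "'t \<Rightarrow> real"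
    assume "1 \<le> l" "w \<in> tverts G" "u \<in> desc G k w" "v \<in> desc G k w" "u \<noteq> v"
      "\<And>x. x \<in> desc G l u \<Longrightarrow> f x = 1" "\<And>x. x \<in> desc G l v \<Longrightarrow> f x = 0"
    then show "e l \<le> c * energy G P p (vheight G w + (k + l)) (desc G (k + l) w) f" by (rule gap)
  qed (rule that)
  define Em where "Em = Max (e ` {..k})"
  \<comment> \<open>Decay gives \<open>e m \<le> e (m - k)\<close>, so the maximum over the first
    scales bounds all of them.\<close>
  have Em: "e m \<le> Em" for m
  proof (induction m rule: less_induct)
    case (less m)
    show ?case
    proof (cases "m \<le> k")
      case True
      then show ?thesis unfolding Em_def by (intro Max_ge) auto
    next
      case False
      then have "3 powr p * e m \<le> e (m - k)" using dec[of "m - k"] by simp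
      moreover have "1 * e m \<le> 3 powr p * e m"
        using assms(1) e(1) by (intro mult_right_mono ge_one_powr_ge_zero) auto
      ultimately show ?thesis using less[of "m - k"] False assms(2) by auto
    qed
  qed
  define C where "C = 3 powr p * max B Em"
  have C0: "0 \<le> C" using B by (simp add: C_def max_def)
  have "disparity G P \<mu> p m * sup_conductance G P Mstar p m \<le> ennreal C" for m
  \<comment> \<open>With a vanishing conductance constant the product is 0 whatever the disparity,
    since 0 times infinity is 0 in \<open>ennreal\<close>.\<close>
  proof (cases "e m = 0")
    case True
    then show ?thesis using e(2) by simp
  next
    case False
    with e(1)[of m] have em: "0 < e m" by simp
    have "disparity G P \<mu> p m \<le> ennreal (C / e m)"
      unfolding disparity_def pair_disparity_def
    proof (intro SUP_least, clarify, intro SUP_least)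
      fix n w v and f :: "'t \<Rightarrow> real"
      assume wv: "(w, v) \<in> cell_edges G P n"
      define d where "d = \<bar>cell_mean P \<mu> (desc G m w) f - cell_mean P \<mu> (desc G m v) f\<bar> powr p"
      define E where "E = energy G P p (n + m) (desc G m w \<union> desc G m v) f"
      have E0: "0 \<le> E" by (simp add: E_def energy_nonneg)
      have bd: "e m * d \<le> C * E"
        using mean_difference_bound[where e = e, OF assms(1) e(1) Em B(1) B(2) wv] by (simp add: C_def d_def E_def mult.assoc)
      show "ennreal d / ennreal E \<le> ennreal (C / e m)"
      \<comment> \<open>Zero energy forces equal means, and the quotient 0/0 has the value 0 in
        \<open>ennreal\<close>.\<close>
      proof (cases "E = 0")
        case True
        then have "d = 0" using bd em by (simp add: d_def mult_le_0_iff)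
        then show ?thesis by simp
      next
        case False
        with E0 have "0 < E" by simp
        moreover have "d / E \<le> C / e m" using bd \<open>0 < E\<close> em by (simp add: field_simps)
        moreover have "0 \<le> d" by (simp add: d_def)
        ultimately show ?thesis by (simp add: divide_ennreal ennreal_leI)
      qed
    qed
    then have "disparity G P \<mu> p m * sup_conductance G P Mstar p m \<le> ennreal (C / e m) * ennreal (e m)"
      unfolding e(2) by (rule mult_right_mono) simp
    also have "\<dots> = ennreal C" using em C0 by (simp add: ennreal_mult'[symmetric])
    finally show ?thesis .
  qed
  then have "(SUP m. disparity G P \<mu> p m * sup_conductance G P Mstar p m) \<le> ennreal C" by (rule SUP_least)
  then show ?thesis unfolding conductively_homogeneous_def by (rule order_le_less_trans) simp
qed

section \<open>Local conductance bounds from homogeneity\<close>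

lemma mean_difference_le_disparity:
  assumes "0 < p" "1 \<le> n" "(w, v) \<in> cell_edges G P n" "disparity G P \<mu> p m = ennreal s" "0 \<le> s"
  shows "\<bar>cell_mean P \<mu> (desc G m w) f - cell_mean P \<mu> (desc G m v) f\<bar> powr p
    \<le> s * energy G P p (n + m) (desc G m w \<union> desc G m v) f"
proof -
  let ?A = "desc G m w \<union> desc G m v"
  let ?d = "\<bar>cell_mean P \<mu> (desc G m w) f - cell_mean P \<mu> (desc G m v) f\<bar> powr p"
  let ?E = "energy G P p (n + m) ?A f"
  have lv: "w \<in> level G n" "v \<in> level G n" "P w \<inter> P v \<noteq> {}" using assms(3) by (auto simp: cell_edges_def)
  then have tv: "w \<in> tverts G" "v \<in> tverts G" by (auto simp: level_def)
  show ?thesis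
  proof (cases "f constant_on ?A")
    case True
    then obtain a where "\<And>x. x \<in> ?A \<Longrightarrow> f x = a" by (auto simp: constant_on_def)
    then have "cell_mean P \<mu> (desc G m w) f = a" "cell_mean P \<mu> (desc G m v) f = a"
      using cell_mean_const tv by auto
    then show ?thesis using assms(5) energy_nonneg[of G P p "n + m" ?A f] by simp
  next
    case False
    \<comment> \<open>The descendants of two touching cells form a chain-connected set, so zero
      energy would make \<open>f\<close> constant. Hence the quotient in the disparity is an honest
      division.\<close>
    have "?E \<noteq> 0"
    proof
      assume 0: "?E = 0"
      have "f x = f y" if "x \<in> ?A" "y \<in> ?A" for x y
      proof -
        have "?A \<subseteq> level G (n + m)" using desc_subset_level lv by blast
        from connected_le_energy[OF _ this assms(1) desc_pair_chain[OF tv lv(3) that], of f]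
        show ?thesis using 0 in_tree(3) tv by simp
      qed
      then have "f constant_on ?A" unfolding constant_on_def by blast
      with False show False by blast
    qed
    with energy_nonneg[of G P p "n + m" ?A f] have E: "0 < ?E" by simp
    have "ennreal ?d / ennreal ?E \<le> pair_disparity G P \<mu> p n m w v"
      unfolding pair_disparity_def using False by (intro SUP_upper2[of f]) auto
    also have "\<dots> \<le> disparity G P \<mu> p m"
      unfolding disparity_def using assms(2,3) by (intro SUP_upper2[of n] SUP_upper2[of "(w, v)"]) auto
    finally have "ennreal (?d / ?E) \<le> ennreal s" using E assms(4) by (simp add: divide_ennreal)
    then have "?d / ?E \<le> s" using assms(5) by simp
    then show ?thesis using E by (simp add: field_simps)
  qed
qed

theorem homogeneous_imp_local_conductance:
  assumes "0 < p" "conductively_homogeneous G P \<mu> Mstar p" "1 \<le> k"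
  shows "\<exists>c>0. \<forall>m\<ge>1. \<forall>w\<in>tverts G. \<forall>u\<in>desc G k w. \<forall>v\<in>desc G k w. u \<noteq> v \<longrightarrow>
       sup_conductance G P Mstar p m
         \<le> ennreal c * conductance G P p (vheight G w + k) m {u} {v} (desc G k w)"
proof -
  obtain e where e: "\<And>m. 0 \<le> e m" "\<And>m. sup_conductance G P Mstar p m = ennreal (e m)"
    using sup_conductance_real[OF assms(1), of Mstar] by blast
  obtain \<gamma> where \<gamma>: "0 < \<gamma>" "\<And>w k. w \<in> tverts G \<Longrightarrow> card (desc G k w) \<le> 1 / \<gamma> ^ k"
    using measure_lower by metis
  define C where "C = enn2real (SUP m. disparity G P \<mu> p m * sup_conductance G P Mstar p m)"
  have C0: "0 \<le> C" by (simp add: C_def)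
  have C: "disparity G P \<mu> p m * ennreal (e m) \<le> ennreal C" for m
  proof -
    have "disparity G P \<mu> p m * sup_conductance G P Mstar p m
        \<le> (SUP m. disparity G P \<mu> p m * sup_conductance G P Mstar p m)" by (rule SUP_upper) simp
    also have "\<dots> = ennreal C"
      using assms(2) by (simp add: C_def conductively_homogeneous_def less_top)
    finally show ?thesis using e(2) by simp
  qed
  define N where "N = ((1 / \<gamma> ^ k)\<^sup>2) powr p"
  \<comment> \<open>The summand 1 keeps \<open>c\<close> positive even if \<open>C\<close> is
    0.\<close>
  define c where "c = N * C + 1"
  have N0: "0 \<le> N" and c0: "0 < c" using C0 by (auto simp: N_def c_def add_nonneg_pos)
  have "sup_conductance G P Mstar p m
         \<le> ennreal c * conductance G P p (vheight G w + k) m {u} {v} (desc G k w)"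
    if w: "w \<in> tverts G" and uv: "u \<in> desc G k w" "v \<in> desc G k w" for m w u v
  proof -
    have "ennreal (e m / c) \<le> conductance G P p (vheight G w + k) m {u} {v} (desc G k w)"
      unfolding conductance_def
    proof (rule INF_greatest)
      fix f :: "'t \<Rightarrow> real"
      assume "f \<in> {f. (\<forall>x\<in>desc_set G m {u}. f x = 1) \<and> (\<forall>x\<in>desc_set G m {v}. f x = 0)}"
      then have f: "\<And>x. x \<in> desc G m u \<Longrightarrow> f x = 1" "\<And>x. x \<in> desc G m v \<Longrightarrow> f x = 0"
        by (auto simp: desc_set_def)
      let ?n = "vheight G w + k + m" and ?A = "desc_set G m (desc G k w)"
      let ?E = "energy G P p ?n ?A f"
      have E0: "0 \<le> ?E" by (rule energy_nonneg)
      have lev: "desc G k w \<subseteq> level G (vheight G w + k)" using desc_subset_level[OF level_self[OF w]] .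
      have finA: "finite ?A" using in_tree(3)[OF w, of "k + m"] desc_add[OF tree] by simp
      have "e m \<le> c * ?E"
      \<comment> \<open>An infinite disparity is compatible with a bounded product only if
        \<open>e m\<close> is 0, and then the claim is trivial.\<close>
      proof (cases "disparity G P \<mu> p m = \<infinity>")
        case True
        then have "e m = 0" using C[of m] e(1)[of m]
          by (cases "e m = 0") (auto simp: ennreal_top_mult top_unique)
        then show ?thesis using E0 c0 by simp
      next
        case False
        then obtain s where s: "disparity G P \<mu> p m = ennreal s" "0 \<le> s"
          by (cases "disparity G P \<mu> p m") auto
        let ?a = "\<lambda>x. cell_mean P \<mu> (desc G m x) f"
        have path: "\<bar>?a u - ?a y\<bar> \<le> j * (s * ?E) powr (1 / p)"
          if "(u, y) \<in> touching P (desc G k w) ^^ j" for j y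
          using that
        proof (induction j arbitrary: y)
          case 0
          then show ?case by simp
        next
          case (Suc j)
          then obtain z where z: "(u, z) \<in> touching P (desc G k w) ^^ j" "(z, y) \<in> touching P (desc G k w)" by auto
          have "\<bar>?a z - ?a y\<bar> powr p \<le> s * ?E"
          proof (cases "z = y")
            case True
            then show ?thesis using s E0 by simp
          next
            case False
            then have "(z, y) \<in> cell_edges G P (vheight G w + k)"
              using z(2) lev by (auto simp: cell_edges_def touching_def)
            \<comment> \<open>Since k is at least 1, the pair lies on a positive level, as the
              supremum in \<open>disparity\<close> requires.\<close>
            from mean_difference_le_disparity[OF assms(1) _ this s, of f]
            have "\<bar>?a z - ?a y\<bar> powr p \<le> s * energy G P p ?n (desc G m z \<union> desc G m y) f"
              using assms(3) by simp
            also have "\<dots> \<le> s * ?E"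
              using z(2) finA s by (intro mult_left_mono energy_mono_set) (auto simp: touching_def desc_set_def)
            finally show ?thesis .
          qed
          then have "(\<bar>?a z - ?a y\<bar> powr p) powr (1 / p) \<le> (s * ?E) powr (1 / p)"
            using assms(1) by (intro powr_mono2) auto
          then have "\<bar>?a z - ?a y\<bar> \<le> (s * ?E) powr (1 / p)" using assms(1) by (simp add: powr_powr)
          then show ?case using Suc.IH[OF z(1)] by (simp add: algebra_simps)
        qed
        obtain j where j: "j \<le> (card (desc G k w))\<^sup>2" "(u, v) \<in> touching P (desc G k w) ^^ j"
          using touching_trancl_le_card[OF in_tree(3)[OF w] desc_chain[OF w uv]] .
        have "?a u = 1" "?a v = 0" using cell_mean_const f desc_tverts[OF w] uv by (metis subsetD)+
        then have "1 \<le> j * (s * ?E) powr (1 / p)" using path[OF j(2)] by simp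
        also have "\<dots> \<le> (1 / \<gamma> ^ k)\<^sup>2 * (s * ?E) powr (1 / p)"
        proof (rule mult_right_mono)
          have "real j \<le> real ((card (desc G k w))\<^sup>2)" using j(1) by simp
          also have "\<dots> \<le> (1 / \<gamma> ^ k)\<^sup>2" using \<gamma>(2)[OF w, of k] unfolding of_nat_power by (intro power_mono) auto
          finally show "real j \<le> (1 / \<gamma> ^ k)\<^sup>2" .
        qed simp
        finally have "1 powr p \<le> ((1 / \<gamma> ^ k)\<^sup>2 * (s * ?E) powr (1 / p)) powr p"
          using assms(1) by (intro powr_mono2) auto
        also have "\<dots> = N * (s * ?E)"
          using assms(1) s E0 by (simp add: powr_mult powr_powr N_def)
        finally have "e m * 1 \<le> e m * (N * (s * ?E))" using e(1) by (intro mult_left_mono) auto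
        also have "\<dots> = N * (s * e m) * ?E" by (simp add: mult_ac)
        also have "\<dots> \<le> N * C * ?E"
        proof -
          have "s * e m \<le> C" using C[of m] s e(1) C0 by (simp add: ennreal_mult'[symmetric])
          then show ?thesis using N0 E0 by (intro mult_right_mono mult_left_mono)
        qed
        also have "\<dots> \<le> c * ?E" using E0 by (intro mult_right_mono) (auto simp: c_def)
        finally show ?thesis by simp
      qed
      then show "ennreal (e m / c) \<le> ennreal ?E" using c0 by (intro ennreal_leI) (simp add: field_simps)
    qed
    then have "ennreal c * ennreal (e m / c) \<le> ennreal c * conductance G P p (vheight G w + k) m {u} {v} (desc G k w)"
      by (intro mult_left_mono) auto
    moreover have "ennreal c * ennreal (e m / c) = ennreal (e m)" using c0 e(1) by (simp add: ennreal_mult'[symmetric])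
    ultimately show ?thesis using e(2) by simp
  qed
  with c0 show ?thesis by blast
qed

end

section \<open>Cutoff functions from a quasisymmetric Ahlfors regular metric\<close>

text \<open>If \<open>h 0\<close> were positive, the values 0 and \<open>2 * h 0\<close> would be
  taken at positive points, and by connectedness \<open>h 0\<close> would be taken again between
  them, against injectivity. The limit at 0 makes \<open>h\<close> a useful gauge for small ratios
  of distances.\<close>

lemma homeomorphism_half_line_zero:
  fixes h g :: "real \<Rightarrow> real"
  assumes "homeomorphism {0..} {0..} h g"
  shows "h 0 = 0" "(h \<longlongrightarrow> 0) (at_right 0)"
proof -
  have hg: "\<And>x. 0 \<le> x \<Longrightarrow> g (h x) = x" "\<And>x. 0 \<le> x \<Longrightarrow> h (g x) = x" "\<And>x. 0 \<le> x \<Longrightarrow> 0 \<le> h x"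
    "\<And>x. 0 \<le> x \<Longrightarrow> 0 \<le> g x" and cont: "continuous_on {0..} h"
    using assms unfolding homeomorphism_def by auto
  show 0: "h 0 = 0"
  proof (rule ccontr)
    assume "h 0 \<noteq> 0"
    then have h0: "0 < h 0" using hg(3)[of 0] by simp
    define s t where "s = g (2 * h 0)" and "t = g 0"
    have st: "0 \<le> s" "0 \<le> t" "h s = 2 * h 0" "h t = 0" using hg h0 by (auto simp: s_def t_def)
    have sub: "closed_segment s t \<subseteq> {0..}" using st by (auto simp: closed_segment_eq_real_ivl)
    have "connected (h ` closed_segment s t)"
      using continuous_on_subset[OF cont sub] by (intro connected_continuous_image) auto
    moreover have "h s \<in> h ` closed_segment s t" "h t \<in> h ` closed_segment s t" by auto
    ultimately have "{h t..h s} \<subseteq> h ` closed_segment s t" by (intro connected_contains_Icc)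
    moreover have "h 0 \<in> {h t..h s}" using st h0 by simp
    ultimately obtain x where x: "x \<in> closed_segment s t" "h x = h 0" by auto
    with sub have "x = 0" using hg(1) by (metis atLeast_iff order_refl subsetD)
    with x(1) st have "s = 0 \<or> t = 0" by (auto simp: closed_segment_eq_real_ivl split: if_splits)
    with st h0 show False by auto
  qed
  have "(h \<longlongrightarrow> h 0) (at 0 within {0..})" using cont by (simp add: continuous_on)
  then show "(h \<longlongrightarrow> 0) (at_right 0)" unfolding 0 by (rule tendsto_within_subset) auto
qed

text \<open>Integrates the pointwise count of the sets containing \<open>x\<close>.\<close>

lemma (in finite_measure) sum_measure_le_overlap:
  assumes "finite U" "\<And>u. u \<in> U \<Longrightarrow> B u \<in> sets M" "\<And>u. u \<in> U \<Longrightarrow> B u \<subseteq> A" "A \<in> sets M"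
    and "\<And>x. x \<in> A \<Longrightarrow> card {u \<in> U. x \<in> B u} \<le> N"
  shows "(\<Sum>u\<in>U. measure M (B u)) \<le> real N * measure M A"
proof -
  have "(\<Sum>u\<in>U. measure M (B u)) = (\<integral>x. (\<Sum>u\<in>U. indicator (B u) x) \<partial>M)"
    using assms(2) by (subst Bochner_Integration.integral_sum) (auto simp: emeasure_finite less_top[symmetric])
  also have "\<dots> \<le> (\<integral>x. real N * indicator A x \<partial>M)"
  proof (rule integral_mono)
    fix x
    have "(\<Sum>u\<in>U. indicator (B u) x) = real (card {u \<in> U. x \<in> B u})"
      using assms(1) by (simp add: indicator_def of_bool_def[symmetric] sum_of_bool_eq Int_def)
    also have "\<dots> \<le> real N * indicator A x"
    proof (cases "x \<in> A")
      case False
      then have "{u \<in> U. x \<in> B u} = {}" using assms(3) by blast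
      then show ?thesis using False by (simp only: card.empty) simp
    qed (use assms(5) in simp)
    finally show "(\<Sum>u\<in>U. indicator (B u) x) \<le> real N * indicator A x" .
  qed (use assms in \<open>auto simp: emeasure_finite less_top[symmetric]\<close>)
  also have "\<dots> = real N * measure M A" using assms(4) by simp
  finally show ?thesis .
qed

lemma (in Metric_space) le_diam:
  assumes "mbounded S" "x \<in> S" "y \<in> S" shows "d x y \<le> diam d S"
proof -
  obtain B where "\<And>x y. x \<in> S \<Longrightarrow> y \<in> S \<Longrightarrow> d x y \<le> B" using assms(1) by (auto simp: mbounded_alt)
  then have "bdd_above ((\<lambda>(x, y). d x y) ` (S \<times> S))" by (intro bdd_aboveI[of _ B]) auto
  then show ?thesis unfolding diam_def using assms(2,3)
    by (intro cSUP_upper2[of _ _ "(x, y)"]) auto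
qed

locale quasisymmetric_ahlfors = standing_assumption K d G P \<mu> Mstar r
  for K :: "'k set" and d :: "'k \<Rightarrow> 'k \<Rightarrow> real" and G :: "'t rooted_graph"
    and P :: "'t \<Rightarrow> 'k set" and \<mu> :: "'k measure" and Mstar :: nat and r :: real +
  fixes \<rho> :: "'k \<Rightarrow> 'k \<Rightarrow> real" and \<nu> :: "'k measure" and \<alpha> :: real
  assumes metric_rho: "Metric_space K \<rho>"
    and qs: "quasisymmetric K d \<rho>"
    and reg_nu: "borel_regular (Metric_space.mtopology K \<rho>) \<nu>"
    and ahlfors: "ahlfors_regular K \<rho> \<alpha> \<nu>"
begin

sublocale R: Metric_space K \<rho>
  by (rule metric_rho)

lemma topology_eq: "R.mtopology = mtopology"
  using qs by (simp add: quasisymmetric_def)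

lemma compact_K: "compactin mtopology K" "compactin R.mtopology K"
  using compact topology_eq by (simp_all add: compact_space_def)

lemma d_bounded: "S \<subseteq> K \<Longrightarrow> mbounded S"
  using compactin_imp_mbounded[OF compact_K(1)] mbounded_subset by blast

lemma rho_le_diam: "x \<in> K \<Longrightarrow> y \<in> K \<Longrightarrow> \<rho> x y \<le> diam \<rho> K"
  using R.le_diam[OF R.compactin_imp_mbounded[OF compact_K(2)]] .

lemma root_point: obtains x where "x \<in> K"
  using P_nonempty[OF in_tree(1)] P_root by blast

lemma infinite_K: "infinite K"
proof -
  obtain x where x: "x \<in> K" using root_point .
  have "K \<subseteq> mtopology derived_set_of K"
    using partition in_tree(1) P_root unfolding tree_partition_def by metis
  with x have "infinite (K \<inter> mball x 1)" unfolding derived_set_of_infinite_mball by auto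
  then show ?thesis using finite_Int by blast
qed

lemma diam_rho_pos: "0 < diam \<rho> K"
proof -
  obtain x where x: "x \<in> K" using root_point .
  obtain y where y: "y \<in> K" "y \<noteq> x" using infinite_K x by (metis finite.emptyI finite_insert finite_subset insertCI subsetI)
  have "0 < \<rho> x y" using x y R.mdist_pos_eq by blast
  also have "\<dots> \<le> diam \<rho> K" using rho_le_diam x y by blast
  finally show ?thesis .
qed

section \<open>Measures of balls in the quasisymmetric metric\<close>

lemma space_nu: "space \<nu> = K"
  using reg_nu by (simp add: borel_regular_def)

lemma open_measurable: "openin R.mtopology U \<Longrightarrow> U \<in> sets \<nu>"
  using reg_nu by (auto simp: borel_regular_def)

lemma ball_measurable: "R.mball x s \<in> sets \<nu>"
  by (rule open_measurable) simp

lemma ahlfors_bounds: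
  obtains a1 a2 where "0 < a1" "0 < a2"
    "\<And>x s. x \<in> K \<Longrightarrow> 0 < s \<Longrightarrow> s \<le> diam \<rho> K \<Longrightarrow> ennreal (a1 * s powr \<alpha>) \<le> emeasure \<nu> (R.mball x s)"
    "\<And>x s. x \<in> K \<Longrightarrow> 0 < s \<Longrightarrow> s \<le> diam \<rho> K \<Longrightarrow> emeasure \<nu> (R.mball x s) \<le> ennreal (a2 * s powr \<alpha>)"
proof -
  from ahlfors[unfolded ahlfors_regular_def] obtain a1 a2 where a: "0 < a1" "0 < a2"
    "\<forall>x\<in>K. \<forall>s. 0 < s \<and> s \<le> diam \<rho> K \<longrightarrow> ennreal (a1 * s powr \<alpha>) \<le> emeasure \<nu> (R.mball x s) \<and>
       emeasure \<nu> (R.mball x s) \<le> ennreal (a2 * s powr \<alpha>)"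
    by (elim exE conjE) (rule that)
  show thesis by (rule that[OF a(1,2)]) (simp_all add: a(3))
qed

text \<open>The Ahlfors bound stops at radius \<open>diam \<rho> K\<close>, and one open ball of
  this radius may miss points of \<open>K\<close>; total boundedness provides finitely many that
  cover.\<close>

lemma finite_nu: "finite_measure \<nu>"
proof
  obtain a2 where a2: "\<And>x s. x \<in> K \<Longrightarrow> 0 < s \<Longrightarrow> s \<le> diam \<rho> K \<Longrightarrow>
      emeasure \<nu> (R.mball x s) \<le> ennreal (a2 * s powr \<alpha>)"
    using ahlfors_bounds by metis
  obtain F where F: "finite F" "F \<subseteq> K" "K \<subseteq> (\<Union>x\<in>F. R.mball x (diam \<rho> K))"
    using R.compactin_imp_mtotally_bounded[OF compact_K(2), unfolded R.mtotally_bounded_def,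
        rule_format, OF diam_rho_pos] by (elim exE conjE) (rule that)
  have "emeasure \<nu> (space \<nu>) \<le> emeasure \<nu> (\<Union>x\<in>F. R.mball x (diam \<rho> K))"
    using F ball_measurable by (intro emeasure_mono) (auto simp: space_nu)
  also have "\<dots> \<le> (\<Sum>x\<in>F. emeasure \<nu> (R.mball x (diam \<rho> K)))"
    using F ball_measurable by (intro emeasure_subadditive_finite) auto
  also have "\<dots> < \<infinity>"
    using F a2[OF _ diam_rho_pos order_refl]
    by (simp add: subset_iff) (metis ennreal_less_top order_le_less_trans)
  finally show "emeasure \<nu> (space \<nu>) \<noteq> \<infinity>" by simp
qed

sublocale nu: finite_measure \<nu>
  by (rule finite_nu)

lemma ball_measure_lower:
  obtains a1 where "0 < a1"
    "\<And>x s. x \<in> K \<Longrightarrow> 0 < s \<Longrightarrow> s \<le> diam \<rho> K \<Longrightarrow> a1 * s powr \<alpha> \<le> measure \<nu> (R.mball x s)"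
proof -
  obtain a1 where a1: "0 < a1"
    "\<And>x s. x \<in> K \<Longrightarrow> 0 < s \<Longrightarrow> s \<le> diam \<rho> K \<Longrightarrow> ennreal (a1 * s powr \<alpha>) \<le> emeasure \<nu> (R.mball x s)"
    using ahlfors_bounds by metis
  then show thesis using that[of a1] by (simp add: nu.emeasure_eq_measure)
qed

lemma ball_measure_upper:
  assumes "0 < C"
  obtains A where "0 \<le> A"
    "\<And>x s. x \<in> K \<Longrightarrow> 0 < s \<Longrightarrow> s \<le> diam \<rho> K \<Longrightarrow> measure \<nu> (R.mball x (C * s)) \<le> A * s powr \<alpha>"
proof -
  let ?D = "diam \<rho> K"
  obtain a2 where a2: "0 < a2"
    "\<And>x s. x \<in> K \<Longrightarrow> 0 < s \<Longrightarrow> s \<le> ?D \<Longrightarrow> emeasure \<nu> (R.mball x s) \<le> ennreal (a2 * s powr \<alpha>)"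
    using ahlfors_bounds by metis
  \<comment> \<open>A lower bound for \<open>s powr \<alpha>\<close> when
    \<open>?D / C < s \<le> ?D\<close>, for either sign of \<alpha>. It lets the total mass serve
    where \<open>C * s\<close> exceeds the Ahlfors range.\<close>
  define q where "q = min (?D powr \<alpha>) ((?D / C) powr \<alpha>)"
  have q: "0 < q" using diam_rho_pos assms by (simp add: q_def)
  define A where "A = max (a2 * C powr \<alpha>) (measure \<nu> K / q)"
  have "measure \<nu> (R.mball x (C * s)) \<le> A * s powr \<alpha>" if x: "x \<in> K" and s: "0 < s" "s \<le> ?D" for x s
  proof (cases "C * s \<le> ?D")
    case True
    then have "emeasure \<nu> (R.mball x (C * s)) \<le> ennreal (a2 * (C * s) powr \<alpha>)"
      using a2(2)[OF x, of "C * s"] s assms by simp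
    then have "measure \<nu> (R.mball x (C * s)) \<le> a2 * (C * s) powr \<alpha>"
      using a2(1) by (simp add: nu.emeasure_eq_measure)
    also have "\<dots> = a2 * C powr \<alpha> * s powr \<alpha>" using s assms by (simp add: powr_mult)
    also have "\<dots> \<le> A * s powr \<alpha>" by (intro mult_right_mono) (auto simp: A_def)
    finally show ?thesis .
  next
    case False
    have "q \<le> s powr \<alpha>"
    proof (cases "0 \<le> \<alpha>")
      case True
      have "(?D / C) powr \<alpha> \<le> s powr \<alpha>"
        using True False s assms diam_rho_pos by (intro powr_mono2) (auto simp: field_simps)
      then show ?thesis by (simp add: q_def)
    next
      case neg: False
      have "?D powr \<alpha> \<le> s powr \<alpha>" using neg s by (intro powr_mono2') auto
      then show ?thesis by (simp add: q_def)
    qed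
    have "measure \<nu> (R.mball x (C * s)) \<le> measure \<nu> K"
      using nu.bounded_measure space_nu by metis
    also have "\<dots> = measure \<nu> K / q * q" using q by simp
    also have "\<dots> \<le> A * s powr \<alpha>"
      using q \<open>q \<le> s powr \<alpha>\<close> by (intro mult_mono) (auto simp: A_def le_max_iff_disj)
    finally show ?thesis .
  qed
  moreover have "0 \<le> A" using a2 by (simp add: A_def le_max_iff_disj)
  ultimately show thesis using that by blast
qed

text \<open>For \<open>\<alpha> \<le> 0\<close> all small balls would have measure bounded below, although \<open>K\<close> contains
  arbitrarily many disjoint ones.\<close>

lemma alpha_pos: "0 < \<alpha>"
proof (rule ccontr)
  assume "\<not> 0 < \<alpha>"
  then have \<alpha>: "\<alpha> \<le> 0" by simp
  let ?D = "diam \<rho> K"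
  obtain a1 where a1: "0 < a1"
    "\<And>x s. x \<in> K \<Longrightarrow> 0 < s \<Longrightarrow> s \<le> ?D \<Longrightarrow> a1 * s powr \<alpha> \<le> measure \<nu> (R.mball x s)"
    using ball_measure_lower by blast
  obtain N :: nat where N: "measure \<nu> K / a1 < N" using reals_Archimedean2 by blast
  obtain F where F: "F \<subseteq> K" "finite F" "card F = N"
    using infinite_arbitrarily_large[OF infinite_K] by blast
  \<comment> \<open>The least element \<open>s\<close> makes the balls disjoint by the half
    distances, keeps \<open>s\<close> in the Ahlfors range by \<open>?D\<close>, and gives
    \<open>1 \<le> s powr \<alpha>\<close> by the entry 1.\<close>
  define T where "T = insert 1 (insert ?D ((\<lambda>(x, y). \<rho> x y / 2) ` {(x, y) \<in> F \<times> F. x \<noteq> y}))"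
  have "{(x, y) \<in> F \<times> F. x \<noteq> y} \<subseteq> F \<times> F" by auto
  then have finT: "finite T" using F(2) finite_subset[of _ "F \<times> F"] by (auto simp: T_def)
  define s where "s = Min T"
  have Tpos: "0 < t" if "t \<in> T" for t
    using that F(1) diam_rho_pos R.mdist_pos_eq unfolding T_def by (auto simp: subset_iff)
  have s: "0 < s" "s \<le> 1" "s \<le> ?D" using Tpos Min_in[OF finT] Min_le[OF finT]
    by (auto simp: s_def T_def)
  have sep: "2 * s \<le> \<rho> x y" if "x \<in> F" "y \<in> F" "x \<noteq> y" for x y
  proof -
    have "\<rho> x y / 2 \<in> T" using that by (auto simp: T_def)
    from Min_le[OF finT this] show ?thesis by (simp add: s_def)
  qed
  have disj: "disjoint_family_on (\<lambda>x. R.mball x s) F"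
    unfolding disjoint_family_on_def
  proof (intro ballI impI)
    fix x y assume xy: "x \<in> F" "y \<in> F" "x \<noteq> y"
    show "R.mball x s \<inter> R.mball y s = {}"
    proof (rule ccontr)
      assume "R.mball x s \<inter> R.mball y s \<noteq> {}"
      then obtain z where z: "z \<in> K" "\<rho> x z < s" "\<rho> y z < s" by (auto simp: R.mball_def)
      have "\<rho> x y \<le> \<rho> x z + \<rho> y z" using R.triangle[of x z y] R.commute[of z y] xy F(1) z by auto
      with z sep[OF xy] show False by simp
    qed
  qed
  have "a1 \<le> measure \<nu> (R.mball x s)" if "x \<in> F" for x
  proof -
    have "1 \<le> s powr \<alpha>" using s \<alpha> powr_mono2'[of \<alpha> s 1] by simp
    then have "a1 * 1 \<le> a1 * s powr \<alpha>" using a1(1) by (intro mult_left_mono) auto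
    also have "\<dots> \<le> measure \<nu> (R.mball x s)" using a1(2) s that F(1) by blast
    finally show ?thesis by simp
  qed
  then have "real (card F) * a1 \<le> (\<Sum>x\<in>F. measure \<nu> (R.mball x s))"
    by (intro sum_bounded_below) auto
  also have "\<dots> = measure \<nu> (\<Union>x\<in>F. R.mball x s)"
    using F(2) ball_measurable disj by (intro nu.finite_measure_finite_Union[symmetric]) auto
  also have "\<dots> \<le> measure \<nu> K" using nu.bounded_measure space_nu by metis
  finally show False using N a1(1) F(3) by (simp add: field_simps)
qed

lemma qs_control:
  obtains h :: "real \<Rightarrow> real" where "(h \<longlongrightarrow> 0) (at_right 0)"
    "\<And>x y z t. x \<in> K \<Longrightarrow> y \<in> K \<Longrightarrow> z \<in> K \<Longrightarrow> 0 \<le> t \<Longrightarrow> d x z \<le> t * d x y \<Longrightarrow> \<rho> x z \<le> h t * \<rho> x y"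
  using qs homeomorphism_half_line_zero(2) unfolding quasisymmetric_def by blast

end

section \<open>Separation, size and centres of cells\<close>

context standing_assumption
begin

text \<open>At generation \<open>n + j\<close> with \<open>j = Mstar + 2\<close>, points closer than
  \<open>c1 * r ^ (n + j)\<close> are joined by a chain of \<open>Mstar\<close> steps, by condition
  (2B). One step to enter it, one to leave it and \<open>Mstar\<close> steps on to the ancestor of
  \<open>u'\<close> make \<open>Mstar + j\<close> in total, which j generations shorten to
  \<open>Mstar\<close>. Hence \<open>a = c1 * r ^ j\<close>.\<close>

lemma cell_separation:
  obtains a where "0 < a"
    "\<And>n k w u u' x y. 1 \<le> n \<Longrightarrow> Mstar + 2 \<le> k \<Longrightarrow> w \<in> level G n \<Longrightarrow> u \<in> level G (n + k) \<Longrightarrow>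
      x \<in> P w \<Longrightarrow> y \<in> P u \<Longrightarrow> d x y < a * r ^ n \<Longrightarrow>
      (u, u') \<in> touching P (level G (n + k)) ^^ Mstar \<Longrightarrow>
      (w, (parent G ^^ k) u') \<in> touching P (level G n) ^^ Mstar"
proof -
  define j where "j = Mstar + 2"
  obtain c1 where c1: "0 < c1" "\<And>x n. x \<in> K \<Longrightarrow> 1 \<le> n \<Longrightarrow> mball x (c1 * r ^ n) \<subseteq> cell_ball G P Mstar x n"
  proof -
    from adapted obtain c1 c2 where c: "0 < c1" "0 < c2" "\<forall>x\<in>K. \<forall>n\<ge>1.
          mball x (c1 * r ^ n) \<subseteq> cell_ball G P Mstar x n \<and>
          cell_ball G P Mstar x n \<subseteq> mball x (c2 * r ^ n)"
      by (elim exE conjE) (rule that)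
    show thesis by (rule that[OF c(1)]) (use c(3) in simp)
  qed
  show thesis
  proof (rule that[of "c1 * r ^ j"])
    show "0 < c1 * r ^ j" using c1 r_bounds by simp
    fix n k w u u' x y
    assume n: "1 \<le> n" "Mstar + 2 \<le> k" and w: "w \<in> level G n" and u: "u \<in> level G (n + k)"
      and xy: "x \<in> P w" "y \<in> P u" "d x y < c1 * r ^ j * r ^ n"
      and u': "(u, u') \<in> touching P (level G (n + k)) ^^ Mstar"
    let ?L = "level G (n + j)" and ?\<pi> = "parent G ^^ (k - j)"
    have k: "n + k = n + j + (k - j)" "k = j + (k - j)" using n(2) by (auto simp: j_def)
    have xK: "x \<in> K" and yK: "y \<in> K" using P_subset tverts_level w u xy by blast+
    have "y \<in> mball x (c1 * r ^ (n + j))" using xK yK xy(3) by (simp add: power_add mult_ac)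
    then have "y \<in> cell_ball G P Mstar x (n + j)" using c1(2)[OF xK, of "n + j"] n(1) by auto
    then obtain w3 v where wv: "w3 \<in> ?L" "x \<in> P w3" "v \<in> level_nbhd G P Mstar w3" "y \<in> P v"
      by (auto simp: cell_ball_def)
    obtain w2 where w2: "w2 \<in> desc G j w" "x \<in> P w2" using P_desc[OF tverts_level[OF w], of j] xy(1) by blast
    have w2L: "w2 \<in> ?L" and w2a: "(parent G ^^ j) w2 = w"
      using subsetD[OF desc_subset_level[OF w] w2(1)]
        ancestor_unique[OF tree tverts_level[OF w] w2(1)] .
    have uL: "u \<in> level G (n + j + (k - j))" unfolding k(1)[symmetric] by (rule u)
    have \<pi>u: "?\<pi> u \<in> ?L" "y \<in> P (?\<pi> u)"
      using parent_pow_level[OF tree uL] subsetD[OF P_ancestor[OF uL] xy(2)] .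
    have s2: "(w3, v) \<in> touching P ?L ^^ Mstar" using wv(3) level_nbhd_eq[OF wv(1)] by auto
    then have vL: "v \<in> ?L" using touching_pow_mem wv(1) by fast
    have s1: "(w2, w3) \<in> touching P ?L" using w2 w2L wv by (auto simp: touching_def)
    have s3: "(v, ?\<pi> u) \<in> touching P ?L" using vL \<pi>u wv(4) by (auto simp: touching_def)
    have s4: "(?\<pi> u, ?\<pi> u') \<in> touching P ?L ^^ Mstar"
      using touching_parent_pow[where n = "n + j" and j = "k - j", OF _ uL] u' unfolding k(1)[symmetric] .
    have eq: "Mstar + j = Suc Mstar + Suc Mstar" by (simp add: j_def)
    have "(w2, ?\<pi> u') \<in> touching P ?L ^^ (Mstar + j)"
      unfolding eq relpow_add
      using relpow_Suc_I2[OF s1 s2] relpow_Suc_I2[OF s3 s4] by (rule relcompI)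
    note touching_ancestor_shorten[OF this w2L]
    moreover have "(parent G ^^ j) (?\<pi> u') = (parent G ^^ k) u'"
      using k(2) by (metis comp_apply funpow_add)
    ultimately show "(w, (parent G ^^ k) u') \<in> touching P (level G n) ^^ Mstar" using w2a by simp
  qed
qed

lemma cell_diam_bounds:
  obtains b1 b2 where "0 < b1" "0 < b2"
    "\<And>n u. u \<in> level G n \<Longrightarrow> b1 * r ^ n \<le> diam d (P u) \<and> diam d (P u) \<le> b2 * r ^ n"
proof -
  from cell_diam obtain b1 b2 where b: "0 < b1" "0 < b2"
    "\<forall>w\<in>tverts G. b1 * r ^ vheight G w \<le> diam d (P w) \<and> diam d (P w) \<le> b2 * r ^ vheight G w"
    by (elim exE conjE) (rule that)
  show thesis by (rule that[OF b(1,2)]) (use b(3) in \<open>auto simp: level_def\<close>)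
qed

lemma cell_centres:
  obtains c y where "0 < c"
    "\<And>n u. 1 \<le> n \<Longrightarrow> u \<in> level G n \<Longrightarrow> y u \<in> P u \<and> mball (y u) (c * r ^ n) \<subseteq> P u"
proof -
  from thick obtain c where c: "0 < c" "\<forall>n\<ge>1. \<forall>w\<in>level G n. \<exists>x\<in>P w. mball x (c * r ^ n) \<subseteq> P w"
    by (elim exE conjE) (rule that)
  define y where "y = (\<lambda>u. SOME x. x \<in> P u \<and> mball x (c * r ^ vheight G u) \<subseteq> P u)"
  have "y u \<in> P u \<and> mball (y u) (c * r ^ n) \<subseteq> P u" if "1 \<le> n" "u \<in> level G n" for n u
  proof -
    have n: "vheight G u = n" using that by (simp add: level_def)
    have "\<exists>x\<in>P u. mball x (c * r ^ n) \<subseteq> P u" using c(2) that by simp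
    with n have "\<exists>x. x \<in> P u \<and> mball x (c * r ^ vheight G u) \<subseteq> P u" "vheight G u = n" by auto
    from someI_ex[OF this(1)] this(2) show ?thesis by (simp add: y_def)
  qed
  with c(1) show thesis by (rule that)
qed

end

section \<open>Cutoffs with small slopes\<close>

context quasisymmetric_ahlfors
begin

text \<open>The outer \<rho>-radius of a closed d-ball; it converts the scale r^n of a cell into its
  size for \<rho>.\<close>

definition rho_radius :: "'k \<Rightarrow> real \<Rightarrow> real" where
  "rho_radius x t = (SUP z\<in>{z \<in> K. d x z \<le> t}. \<rho> x z)"

lemma rho_radius_upper:
  assumes "x \<in> K" "z \<in> K" "d x z \<le> t" shows "\<rho> x z \<le> rho_radius x t"
  unfolding rho_radius_def using assms rho_le_diam
  by (intro cSUP_upper bdd_aboveI[of _ "diam \<rho> K"]) auto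

lemma rho_radius_least:
  assumes "x \<in> K" "0 \<le> t" "\<And>z. z \<in> K \<Longrightarrow> d x z \<le> t \<Longrightarrow> \<rho> x z \<le> b" shows "rho_radius x t \<le> b"
  unfolding rho_radius_def using assms by (intro cSUP_least) auto

lemma chain_dist:
  assumes b2: "\<And>n u. u \<in> level G n \<Longrightarrow> diam d (P u) \<le> b2 * r ^ n"
    and "u \<in> level G n" "(u, v) \<in> touching P (level G n) ^^ j" "x \<in> P u" "y \<in> P v"
  shows "d x y \<le> (real j + 1) * b2 * r ^ n"
  using assms(3,5)
proof (induction j arbitrary: v y)
  case 0
  then have "d x y \<le> diam d (P u)"
    using assms(2,4) P_subset[OF tverts_level] d_bounded by (intro le_diam) auto
  with b2[OF assms(2)] show ?case by simp
next
  case (Suc j)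
  then obtain v' where v': "(u, v') \<in> touching P (level G n) ^^ j" "(v', v) \<in> touching P (level G n)" by auto
  then obtain z where z: "z \<in> P v'" "z \<in> P v" by (auto simp: touching_def)
  have v: "v \<in> level G n" "v' \<in> level G n" using v' by (auto simp: touching_def)
  have K: "x \<in> K" "y \<in> K" "z \<in> K" using P_subset[OF tverts_level] assms(2,4) v z Suc.prems(2) by blast+
  have "d z y \<le> diam d (P v)"
    using P_subset[OF tverts_level[OF v(1)]] d_bounded z Suc.prems(2) by (intro le_diam) auto
  also have "\<dots> \<le> b2 * r ^ n" using b2[OF v(1)] .
  finally show ?case using triangle[OF K(1,3,2)] Suc.IH[OF v'(1) z(1)] by (simp add: algebra_simps)
qed

text \<open>The cutoff decreases linearly in the \<rho>-distance to \<open>P w\<close>, sampled at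
  cell centres, with slope \<open>L u / R0\<close>. Ahlfors regularity turns
  \<open>L u powr \<alpha>\<close> into the mass of a ball inside \<open>P u\<close>; these balls
  overlap at most \<open>N\<close> times inside one ball about \<open>y w\<close>, so the sum of the
  \<alpha>-powers is bounded independently of \<open>k\<close>.\<close>

lemma cutoff_exists:
  assumes "\<alpha> < p" "0 < \<epsilon>"
  obtains k where "1 \<le> k" "\<And>n w. 1 \<le> n \<Longrightarrow> w \<in> level G n \<Longrightarrow> has_cutoff p \<epsilon> k n w"
proof -
  obtain b1 b2 where b: "0 < b1" "0 < b2"
    "\<And>n u. u \<in> level G n \<Longrightarrow> b1 * r ^ n \<le> diam d (P u) \<and> diam d (P u) \<le> b2 * r ^ n"
    using cell_diam_bounds by metis
  obtain c y where c: "0 < c"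
    "\<And>n u. 1 \<le> n \<Longrightarrow> u \<in> level G n \<Longrightarrow> y u \<in> P u \<and> mball (y u) (c * r ^ n) \<subseteq> P u"
    using cell_centres by metis
  obtain a where a: "0 < a"
    "\<And>n k w u u' x y. 1 \<le> n \<Longrightarrow> Mstar + 2 \<le> k \<Longrightarrow> w \<in> level G n \<Longrightarrow> u \<in> level G (n + k) \<Longrightarrow>
      x \<in> P w \<Longrightarrow> y \<in> P u \<Longrightarrow> d x y < a * r ^ n \<Longrightarrow>
      (u, u') \<in> touching P (level G (n + k)) ^^ Mstar \<Longrightarrow>
      (w, (parent G ^^ k) u') \<in> touching P (level G n) ^^ Mstar"
    using cell_separation by blast
  obtain h where h: "(h \<longlongrightarrow> 0) (at_right 0)"
    "\<And>x y z t. x \<in> K \<Longrightarrow> y \<in> K \<Longrightarrow> z \<in> K \<Longrightarrow> 0 \<le> t \<Longrightarrow> d x z \<le> t * d x y \<Longrightarrow> \<rho> x z \<le> h t * \<rho> x y"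
    using qs_control by blast
  obtain a1 where a1: "0 < a1"
    "\<And>x s. x \<in> K \<Longrightarrow> 0 < s \<Longrightarrow> s \<le> diam \<rho> K \<Longrightarrow> a1 * s powr \<alpha> \<le> measure \<nu> (R.mball x s)"
    using ball_measure_lower by blast
  obtain A where A: "0 \<le> A"
    "\<And>x s. x \<in> K \<Longrightarrow> 0 < s \<Longrightarrow> s \<le> diam \<rho> K \<Longrightarrow> measure \<nu> (R.mball x (3 * s)) \<le> A * s powr \<alpha>"
    using ball_measure_upper[of 3] by auto
  obtain N where N: "\<And>n x. x \<in> K \<Longrightarrow> card {u \<in> level G n. x \<in> P u} \<le> N"
    using overlap_bound by metis

  \<comment> \<open>A chain of \<open>Suc Mstar\<close> steps runs through \<open>Mstar + 2\<close>
    cells, each of d-diameter at most \<open>b2\<close> times the scale.\<close>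
  define C where "C = (real Mstar + 2) * b2"
  \<comment> \<open>\<open>H\<close> compares the outer radius of a cell with that of a ball inside
    it; \<open>Hs\<close> compares the surroundings of \<open>P w\<close> with points at d-distance
    \<open>a * r ^ n\<close>.\<close>
  define H where "H = max 1 (h (C / c))"
  define Hs where "Hs = max 1 (h (2 * C / a))"
  define Q where "Q = (2 * Hs) powr \<alpha> * H powr \<alpha> * N * A / a1"
  define \<eta> where "\<eta> = (\<epsilon> / (Q + 1)) powr (1 / (p - \<alpha>))"
  have C: "0 < C" "b2 \<le> C" using b by (simp_all add: C_def mult_le_cancel_right1)
  have H: "1 \<le> H" "h (C / c) \<le> H" and Hs: "1 \<le> Hs" "h (2 * C / a) \<le> Hs" by (auto simp: H_def Hs_def)
  have Q: "0 \<le> Q" using A a1 by (simp add: Q_def)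
  have \<eta>: "0 < \<eta>" using assms Q by (simp add: \<eta>_def)
  have \<eta>Q: "\<eta> powr (p - \<alpha>) * Q \<le> \<epsilon>"
  proof -
    have "\<eta> powr (p - \<alpha>) = \<epsilon> / (Q + 1)" using assms Q by (simp add: \<eta>_def powr_powr)
    moreover have "\<epsilon> / (Q + 1) * Q \<le> \<epsilon>" using assms(2) Q by (simp add: field_simps)
    ultimately show ?thesis by simp
  qed
  \<comment> \<open>The bound 1/3 keeps the small balls inside radius \<open>3 * Lw\<close>; the
    other one yields slopes at most \<eta>, as
    \<open>3 * \<tau> * Lw / R0 = 6 * Hs * \<tau>\<close>.\<close>
  define \<tau> where "\<tau> = min (1 / 3) (\<eta> / (6 * Hs))"
  have \<tau>: "0 < \<tau>" using \<eta> Hs by (simp add: \<tau>_def)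
  \<comment> \<open>The argument of \<open>h\<close> is the ratio of the scale
    \<open>C * r ^ (n + k)\<close> to the distance \<open>b1 / 8 * r ^ n\<close> provided by
    \<open>far\<close>; it is free of \<open>n\<close>, so one \<open>k\<close> serves all
    cells.\<close>
  obtain k where k: "1 \<le> k" "Mstar + 2 \<le> k" "h (8 * C / b1 * r ^ k) < \<tau>"
  proof -
    have "(\<lambda>k. 8 * C / b1 * r ^ k) \<longlonglongrightarrow> 8 * C / b1 * 0"
      using r_bounds by (intro tendsto_mult_left LIMSEQ_realpow_zero) auto
    moreover have "0 < 8 * C / b1 * r ^ k" for k using C b r_bounds by simp
    then have "\<forall>\<^sub>F k in sequentially. 8 * C / b1 * r ^ k \<in> {0<..}
        \<and> 8 * C / b1 * r ^ k \<noteq> 0" by (intro always_eventually allI) (metis greaterThan_iff less_irrefl)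
    ultimately have "filterlim (\<lambda>k. 8 * C / b1 * r ^ k) (at_right 0) sequentially"
      unfolding filterlim_at by simp
    from order_tendstoD(2)[OF filterlim_compose[OF h(1) this] \<tau>]
    obtain k0 where "\<And>k. k0 \<le> k \<Longrightarrow> h (8 * C / b1 * r ^ k) < \<tau>"
      unfolding eventually_sequentially by blast
    then show thesis using that[of "max k0 (Mstar + 2)"] by simp
  qed
  show thesis
  proof (rule that[OF k(1)])
    fix n w
    assume n: "1 \<le> n" and w: "w \<in> level G n"
    let ?X = "level G (n + k)"
    have yP: "y u \<in> P u" "y u \<in> K" if "u \<in> ?X" for u
      using c(2)[of "n + k" u] that n P_subset[OF tverts_level[OF that]] by auto
    have wP: "y w \<in> P w" "y w \<in> K" "P w \<subseteq> K" using c(2)[OF n w] P_subset[OF tverts_level[OF w]] by auto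
    have rn: "0 < r ^ i" for i using r_bounds by simp
    have Crn: "0 \<le> C * r ^ i" for i using mult_pos_pos[OF C(1) rn] by (rule less_imp_le)
    define L where "L = (\<lambda>u. rho_radius (y u) (C * r ^ (n + k)))"
    define Lw where "Lw = rho_radius (y w) (C * r ^ n)"
    define R0 where "R0 = Lw / (2 * Hs)"
    have Pw_dist: "d x x' \<le> b2 * r ^ n" if "x \<in> P w" "x' \<in> P w" for x x'
      using chain_dist[of b2 w n w 0 x x'] b(3) w that by auto
    have Pw_rho: "\<rho> (y w) x \<le> Lw" if "x \<in> P w" for x
      unfolding Lw_def
    proof (rule rho_radius_upper[OF wP(2)])
      show "d (y w) x \<le> C * r ^ n"
        using Pw_dist[OF wP(1) that] mult_right_mono[OF C(2), of "r ^ n"] rn[of n] by linarith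
    qed (use that wP in auto)
    \<comment> \<open>Otherwise \<open>P w\<close> would lie in a ball too small for its diameter.
      The point found is the large reference distance in the quasisymmetry estimates.\<close>
    have far: "\<exists>z\<in>P w. b1 / 8 * r ^ n \<le> d x z" if "x \<in> K" for x
    proof (rule ccontr)
      assume "\<not> ?thesis"
      then have lt: "d x z < b1 / 8 * r ^ n" if "z \<in> P w" for z using that by force
      have "diam d (P w) \<le> b1 / 4 * r ^ n"
        unfolding diam_def
      proof (rule cSUP_least)
        show "P w \<times> P w \<noteq> {}" using wP by auto
        fix q assume "q \<in> P w \<times> P w"
        then obtain s t where st: "q = (s, t)" "s \<in> P w" "t \<in> P w" by auto
        have "d s t \<le> d x s + d x t"
          using triangle[of s x t] commute[of s x] st wP \<open>x \<in> K\<close> by auto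
        with lt[OF st(2)] lt[OF st(3)] show "(case q of (x, y) \<Rightarrow> d x y) \<le> b1 / 4 * r ^ n" using st(1) by simp
      qed
      moreover have "b1 / 4 * r ^ n < b1 * r ^ n" using b(1) rn[of n] by simp
      ultimately show False using b(3)[OF w] by simp
    qed
    have Lw: "0 < Lw" "Lw \<le> diam \<rho> K"
    proof -
      obtain z where z: "z \<in> P w" "b1 / 8 * r ^ n \<le> d (y w) z" using far[OF wP(2)] by blast
      have "0 < d (y w) z" using z(2) b(1) rn[of n] by (smt (verit) divide_pos_pos mult_pos_pos)
      then have "0 < \<rho> (y w) z" using z(1) wP by (metis R.mdist_pos_eq mdist_pos_eq subsetD)
      with Pw_rho[OF z(1)] show "0 < Lw" by simp
      show "Lw \<le> diam \<rho> K"
        unfolding Lw_def using wP Crn rho_le_diam by (intro rho_radius_least) auto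
    qed
    have R0: "0 < R0" "R0 \<le> Lw" using Lw Hs by (auto simp: R0_def field_simps)
    \<comment> \<open>The d-ball defining \<open>Lw\<close> lies within \<open>2 * C * r ^ n\<close>
      of \<open>x\<close>, so quasisymmetry bounds its \<rho>-distances from \<open>x\<close> by
      \<open>Hs * \<rho> x z\<close>; passing through \<open>x\<close> doubles this.\<close>
    have sep: "R0 \<le> \<rho> x z" if x: "x \<in> P w" and z: "z \<in> K" "a * r ^ n \<le> d x z" for x z
    proof -
      have xK: "x \<in> K" using x wP by auto
      have q: "\<rho> x v \<le> Hs * \<rho> x z" if v: "v \<in> K" "d x v \<le> 2 * C * r ^ n" for v
      proof -
        have "2 * C * r ^ n = 2 * C / a * (a * r ^ n)" using a(1) by simp
        also have "\<dots> \<le> 2 * C / a * d x z" using z(2) a(1) C by (intro mult_left_mono) auto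
        finally have "\<rho> x v \<le> h (2 * C / a) * \<rho> x z" using v a(1) C by (intro h(2) xK z) auto
        also have "\<dots> \<le> Hs * \<rho> x z" using Hs by (intro mult_right_mono) auto
        finally show ?thesis .
      qed
      have xw: "d x (y w) \<le> C * r ^ n"
        using Pw_dist[OF x wP(1)] mult_right_mono[OF C(2), of "r ^ n"] rn[of n] by linarith
      have "Lw \<le> 2 * Hs * \<rho> x z"
        unfolding Lw_def
      proof (rule rho_radius_least[OF wP(2)])
        fix v assume v: "v \<in> K" "d (y w) v \<le> C * r ^ n"
        have "d x v \<le> 2 * C * r ^ n" using triangle[OF xK wP(2) v(1)] xw v(2) by simp
        then have "\<rho> x v \<le> Hs * \<rho> x z" using q v(1) by blast
        moreover have "\<rho> x (y w) \<le> Hs * \<rho> x z"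
          using q[OF wP(2)] xw mult_pos_pos[OF C(1) rn[of n]] by simp
        moreover have "\<rho> (y w) v \<le> \<rho> x (y w) + \<rho> x v"
          using R.triangle[OF wP(2) xK v(1)] R.commute[of x "y w"] by simp
        ultimately show "\<rho> (y w) v \<le> 2 * Hs * \<rho> x z" by simp
      qed (rule Crn)
      then show ?thesis using Hs by (simp add: R0_def field_simps)
    qed

    define D where "D = (\<lambda>z. INF x\<in>P w. \<rho> x z)"
    have D_le: "D z \<le> \<rho> x z" if "x \<in> P w" for x z
      unfolding D_def using that by (intro cINF_lower bdd_belowI[of _ 0]) auto
    have D_ge: "t \<le> D z" if "\<And>x. x \<in> P w \<Longrightarrow> t \<le> \<rho> x z" for t z
      unfolding D_def using that wP by (intro cINF_greatest) auto
    have D_lip: "D z' \<le> D z + \<rho> z z'" if "z \<in> K" "z' \<in> K" for z z'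
    proof -
      have "D z' - \<rho> z z' \<le> D z"
      proof (rule D_ge)
        fix x assume x: "x \<in> P w"
        then show "D z' - \<rho> z z' \<le> \<rho> x z"
          using D_le[OF x, of z'] R.triangle[of x z z'] that wP by auto
      qed
      then show ?thesis by simp
    qed
    define f where "f = (\<lambda>u. max 0 (1 - D (y u) / R0))"
    \<comment> \<open>Slopes off the support of \<open>f\<close> are set to 0, which the one-sided
      drop condition allows; thus only cells near \<open>P w\<close> enter the sum.\<close>
    define \<Delta> where "\<Delta> = (\<lambda>u. if 0 < f u then L u / R0 else 0)"
    have L_upper: "\<rho> (y u) z \<le> L u" if "u \<in> ?X" "z \<in> K" "d (y u) z \<le> C * r ^ (n + k)" for u z
      unfolding L_def using yP(2)[OF that(1)] that by (intro rho_radius_upper) auto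
    have L_diam: "L u \<le> diam \<rho> K" if "u \<in> ?X" for u
      unfolding L_def using yP(2)[OF that] Crn rho_le_diam by (intro rho_radius_least) auto
    have L0: "0 \<le> L u" if "u \<in> ?X" for u
      using L_upper[OF that yP(2)[OF that]] yP(2)[OF that] Crn[of "n + k"] by simp
    have near: "\<rho> (y w) (y u) < 2 * Lw" if u: "u \<in> ?X" "0 < f u" for u
    proof -
      have "D (y u) < R0" using u R0 by (simp add: f_def field_simps max_def split: if_splits)
      then obtain x where x: "x \<in> P w" "\<rho> x (y u) < R0" using D_ge[of R0 "y u"] by force
      have "\<rho> (y w) (y u) \<le> \<rho> (y w) x + \<rho> x (y u)"
        using x wP yP(2)[OF u(1)] by (intro R.triangle) auto
      with x R0 Pw_rho[OF x(1)] show ?thesis by simp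
    qed
    have small: "L u \<le> 3 * \<tau> * Lw" if u: "u \<in> ?X" "0 < f u" for u
      unfolding L_def
    proof (rule rho_radius_least)
      show yK: "y u \<in> K" using yP u by blast
      fix z assume z: "z \<in> K" "d (y u) z \<le> C * r ^ (n + k)"
      obtain v where v: "v \<in> P w" "b1 / 8 * r ^ n \<le> d (y u) v" using far[OF yK] by blast
      have vK: "v \<in> K" using v wP by auto
      have "C * r ^ (n + k) = 8 * C / b1 * r ^ k * (b1 / 8 * r ^ n)"
        using b(1) by (simp add: power_add)
      also have "\<dots> \<le> 8 * C / b1 * r ^ k * d (y u) v"
        using v(2) b(1) C rn[of k] by (intro mult_left_mono) auto
      finally have "\<rho> (y u) z \<le> h (8 * C / b1 * r ^ k) * \<rho> (y u) v"
        using z b(1) C rn[of k] by (intro h(2) yK vK z) auto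
      also have "\<dots> \<le> \<tau> * (3 * Lw)"
      proof (rule mult_mono)
        show "\<rho> (y u) v \<le> 3 * Lw"
          using R.triangle[OF yK wP(2) vK] R.commute[of "y u" "y w"] near[OF u] Pw_rho[OF v(1)] by simp
      qed (use k(3) \<tau> in auto)
      finally show "\<rho> (y u) z \<le> 3 * \<tau> * Lw" by simp
    qed (rule Crn)

    \<comment> \<open>A point of \<open>K\<close> outside the inner d-ball of \<open>P u\<close> is,
      by quasisymmetry, at \<rho>-distance at least \<open>L u / H\<close> from the centre.\<close>
    have L_ball: "R.mball (y u) (L u / H) \<subseteq> P u" if u: "u \<in> ?X" for u
    proof
      fix z assume "z \<in> R.mball (y u) (L u / H)"
      then have z: "z \<in> K" "\<rho> (y u) z < L u / H" by (auto simp: R.mball_def)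
      have "d (y u) z < c * r ^ (n + k)"
      proof (rule ccontr)
        assume "\<not> ?thesis"
        then have ge: "c * r ^ (n + k) \<le> d (y u) z" by simp
        have "L u \<le> H * \<rho> (y u) z"
          unfolding L_def
        proof (rule rho_radius_least[OF yP(2)[OF u]])
          fix v assume v: "v \<in> K" "d (y u) v \<le> C * r ^ (n + k)"
          have "C * r ^ (n + k) = C / c * (c * r ^ (n + k))" using c(1) by simp
          also have "\<dots> \<le> C / c * d (y u) z" using ge c(1) C by (intro mult_left_mono) auto
          finally have "\<rho> (y u) v \<le> h (C / c) * \<rho> (y u) z"
            using v c(1) C by (intro h(2) yP(2)[OF u] z(1)) auto
          also have "\<dots> \<le> H * \<rho> (y u) z" using H by (intro mult_right_mono) auto
          finally show "\<rho> (y u) v \<le> H * \<rho> (y u) z" .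
        qed (rule Crn)
        then show False using z(2) H by (simp add: field_simps)
      qed
      then have "z \<in> mball (y u) (c * r ^ (n + k))" using z(1) yP(2)[OF u] by simp
      then show "z \<in> P u" using c(2)[of "n + k" u] u n by auto
    qed

    have sum: "(\<Sum>u\<in>?X. \<Delta> u powr p) \<le> \<epsilon>"
    proof -
      let ?U = "{u \<in> ?X. 0 < f u}" and ?B = "\<lambda>u. R.mball (y u) (L u / H)"
      let ?c = "\<eta> powr (p - \<alpha>) * (H powr \<alpha> / (a1 * R0 powr \<alpha>))"
      have slope: "\<Delta> u powr p \<le> ?c * measure \<nu> (?B u)" if u: "u \<in> ?X" "0 < f u" for u
      proof (cases "L u = 0")
        case True
        then show ?thesis using a1 by (simp add: \<Delta>_def)
      next
        case False
        with L0[OF u(1)] have Lu: "0 < L u" by simp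
        have "L u / R0 \<le> 3 * \<tau> * Lw / R0" using small[OF u] R0 by (intro divide_right_mono) auto
        also have "\<dots> = 6 * Hs * \<tau>" using Lw Hs by (simp add: R0_def)
        also have "\<dots> \<le> 6 * Hs * (\<eta> / (6 * Hs))" using Hs by (intro mult_left_mono) (auto simp: \<tau>_def)
        also have "\<dots> = \<eta>" using Hs by simp
        finally have le: "L u / R0 \<le> \<eta>" .
        have "L u / H \<le> diam \<rho> K" using L_diam[OF u(1)] H Lu by (smt (verit) divide_le_eq_1 frac_le div_by_1)
        then have "a1 * (L u / H) powr \<alpha> \<le> measure \<nu> (?B u)"
          using a1(2)[OF yP(2)[OF u(1)], of "L u / H"] Lu H by simp
        then have mb: "L u powr \<alpha> \<le> H powr \<alpha> / a1 * measure \<nu> (?B u)"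
          using Lu H a1(1) by (simp add: powr_divide field_simps)
        have "\<Delta> u powr p = (L u / R0) powr (p - \<alpha>) * (L u / R0) powr \<alpha>"
          using u by (simp add: \<Delta>_def powr_add[symmetric])
        also have "\<dots> \<le> \<eta> powr (p - \<alpha>) * (L u / R0) powr \<alpha>"
          using le Lu R0 assms(1) by (intro mult_right_mono powr_mono2) auto
        also have "(L u / R0) powr \<alpha> = L u powr \<alpha> / R0 powr \<alpha>" using Lu R0 by (simp add: powr_divide)
        also have "\<eta> powr (p - \<alpha>) * (L u powr \<alpha> / R0 powr \<alpha>)
            \<le> \<eta> powr (p - \<alpha>) * (H powr \<alpha> / a1 * measure \<nu> (?B u) / R0 powr \<alpha>)"
          using mb by (intro mult_left_mono divide_right_mono) auto
        finally show ?thesis by (simp add: field_simps)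
      qed
      have "(\<Sum>u\<in>?X. \<Delta> u powr p) = (\<Sum>u\<in>?U. \<Delta> u powr p)"
        using in_tree(2) by (intro sum.mono_neutral_right) (auto simp: \<Delta>_def)
      also have "\<dots> \<le> (\<Sum>u\<in>?U. ?c * measure \<nu> (?B u))" using slope by (intro sum_mono) auto
      also have "\<dots> = ?c * (\<Sum>u\<in>?U. measure \<nu> (?B u))" by (simp add: sum_distrib_left)
      also have "\<dots> \<le> ?c * (real N * measure \<nu> (R.mball (y w) (3 * Lw)))"
      proof (intro mult_left_mono nu.sum_measure_le_overlap)
        show "?B u \<subseteq> R.mball (y w) (3 * Lw)" if "u \<in> ?U" for u
        proof
          fix z assume "z \<in> ?B u"
          then have z: "z \<in> K" "\<rho> (y u) z < L u / H" by (auto simp: R.mball_def)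
          have u: "u \<in> ?X" "0 < f u" using that by auto
          have "L u / H \<le> L u / 1" using H L0[OF u(1)] by (intro divide_left_mono) auto
          also have "\<dots> = L u" by simp
          also have "\<dots> \<le> 3 * \<tau> * Lw" using small[OF u] .
          also have "\<dots> \<le> 1 * Lw" using Lw by (intro mult_right_mono) (auto simp: \<tau>_def)
          finally have "\<rho> (y u) z < Lw" using z(2) by simp
          then have "\<rho> (y w) z < 3 * Lw"
            using R.triangle[OF wP(2) yP(2)[OF u(1)] z(1)] near[OF u] by simp
          then show "z \<in> R.mball (y w) (3 * Lw)" using z wP by simp
        qed
        show "card {u \<in> ?U. x \<in> ?B u} \<le> N" if "x \<in> R.mball (y w) (3 * Lw)" for x
        proof -
          have "x \<in> K" using that by (simp add: R.mball_def)
          have "card {u \<in> ?U. x \<in> ?B u} \<le> card {u \<in> ?X. x \<in> P u}"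
          proof (rule card_mono)
            show "{u \<in> ?U. x \<in> ?B u} \<subseteq> {u \<in> ?X. x \<in> P u}" using L_ball by blast
          qed (simp add: in_tree(2))
          also have "\<dots> \<le> N" by (rule N[OF \<open>x \<in> K\<close>])
          finally show ?thesis .
        qed
      qed (use a1 in_tree(2) ball_measurable in auto)
      also have "\<dots> \<le> ?c * (real N * (A * Lw powr \<alpha>))"
        using A(2)[OF wP(2) Lw] a1 by (intro mult_left_mono) auto
      also have "\<dots> = \<eta> powr (p - \<alpha>) * Q"
      proof -
        have "R0 powr \<alpha> = Lw powr \<alpha> / (2 * Hs) powr \<alpha>" using Lw Hs by (simp add: R0_def powr_divide)
        then have "(2 * Hs) powr \<alpha> = Lw powr \<alpha> / R0 powr \<alpha>" using Lw R0 Hs by simp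
        then show ?thesis by (simp add: Q_def mult_ac)
      qed
      also have "\<dots> \<le> \<epsilon>" by (rule \<eta>Q)
      finally show ?thesis .
    qed

    have "0 \<le> f u \<and> f u \<le> 1 \<and> 0 \<le> \<Delta> u" if "u \<in> ?X" for u
    proof -
      have "0 \<le> D (y u)" by (rule D_ge) simp
      then show ?thesis using R0 L0[OF that] by (simp add: f_def \<Delta>_def)
    qed
    moreover have "f u = 1" if u: "u \<in> desc G k w" for u
    proof -
      have uX: "u \<in> ?X" using desc_subset_level[OF w] u by blast
      have "P u \<subseteq> P w" using P_desc[OF tverts_level[OF w], of k] u by blast
      then have "y u \<in> P w" using yP(1)[OF uX] by blast
      then have "D (y u) \<le> \<rho> (y u) (y u)" by (rule D_le)
      then have "D (y u) \<le> 0" using yP(2)[OF uX] by simp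
      moreover have "0 \<le> D (y u)" by (rule D_ge) simp
      ultimately show ?thesis by (simp add: f_def)
    qed
    moreover have "f u = 0" if u: "u \<in> ?X" "(u, u') \<in> touching P ?X ^^ Mstar"
        "(w, (parent G ^^ k) u') \<notin> touching P (level G n) ^^ Mstar" for u u'
    proof -
      have "R0 \<le> D (y u)"
      proof (rule D_ge)
        fix x assume x: "x \<in> P w"
        have "\<not> d x (y u) < a * r ^ n" using a(2)[OF n k(2) w u(1) x yP(1)[OF u(1)] _ u(2)] u(3) by blast
        then show "R0 \<le> \<rho> x (y u)" using sep[OF x yP(2)[OF u(1)]] by simp
      qed
      then show ?thesis using R0 by (simp add: f_def)
    qed
    moreover have "f u - \<Delta> u \<le> f u'" if u: "u \<in> ?X" "(u, u') \<in> touching P ?X ^^ Suc Mstar" for u u'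
    proof (cases "0 < f u")
      case True
      have u': "u' \<in> ?X" using touching_pow_mem[OF u(2,1)] .
      have "d (y u) (y u') \<le> (real (Suc Mstar) + 1) * b2 * r ^ (n + k)"
        using chain_dist[OF _ u yP(1)[OF u(1)] yP(1)[OF u']] b(3) by blast
      then have "\<rho> (y u) (y u') \<le> L u" using L_upper[OF u(1) yP(2)[OF u']] by (simp add: C_def add_ac)
      then have "D (y u') \<le> D (y u) + L u" using D_lip[OF yP(2)[OF u(1)] yP(2)[OF u']] by simp
      then have "D (y u') / R0 \<le> D (y u) / R0 + L u / R0"
        using R0 by (simp add: add_divide_distrib[symmetric] divide_right_mono)
      moreover have "f u = 1 - D (y u) / R0" using True by (simp add: f_def max_def split: if_splits)
      ultimately show ?thesis using True by (simp add: \<Delta>_def f_def)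
    next
      case False
      then show ?thesis by (simp add: \<Delta>_def f_def)
    qed
    ultimately show "has_cutoff p \<epsilon> k n w"
      unfolding has_cutoff_def
      using sum by (intro exI[of _ f] exI[of _ \<Delta>]) blast
  qed
qed

end

theorem theorem1p4:
  fixes K :: "'k set" and d :: "'k \<Rightarrow> 'k \<Rightarrow> real"
    and G :: "'t rooted_graph" and P :: "'t \<Rightarrow> 'k set" and \<mu> :: "'k measure"
    and Mstar :: nat and r p :: real
  assumes "standing_assumption K d G P \<mu> Mstar r"
    and "dim_AR K d < ereal p"
  shows "conductively_homogeneous G P \<mu> Mstar p \<longleftrightarrow>
    (\<forall>k\<ge>1. \<exists>c>0. \<forall>m\<ge>1. \<forall>w\<in>tverts G. \<forall>u\<in>desc G k w. \<forall>v\<in>desc G k w. u \<noteq> v \<longrightarrow>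
       sup_conductance G P Mstar p m
         \<le> ennreal c * conductance G P p (vheight G w + k) m {u} {v} (desc G k w))"
proof -
  interpret standing_assumption K d G P \<mu> Mstar r by fact
  obtain \<alpha> \<rho> \<nu> where \<alpha>: "\<alpha> < p" and "Metric_space K \<rho>" "quasisymmetric K d \<rho>"
    "borel_regular (Metric_space.mtopology K \<rho>) \<nu>" "ahlfors_regular K \<rho> \<alpha> \<nu>"
    using assms(2) unfolding dim_AR_def Inf_less_iff by auto
  then interpret quasisymmetric_ahlfors K d G P \<mu> Mstar r \<rho> \<nu> \<alpha>
    by (intro quasisymmetric_ahlfors.intro quasisymmetric_ahlfors_axioms.intro assms(1))
  \<comment> \<open>The sign of p is inherited from the Ahlfors exponent.\<close>
  have p: "0 < p" using alpha_pos \<alpha> by simp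
  show ?thesis
  proof (intro iffI allI impI)
    fix k :: nat
    assume "conductively_homogeneous G P \<mu> Mstar p" "1 \<le> k"
    from homogeneous_imp_local_conductance[OF p this]
    show "\<exists>c>0. \<forall>m\<ge>1. \<forall>w\<in>tverts G. \<forall>u\<in>desc G k w. \<forall>v\<in>desc G k w. u \<noteq> v \<longrightarrow>
       sup_conductance G P Mstar p m
         \<le> ennreal c * conductance G P p (vheight G w + k) m {u} {v} (desc G k w)" .
  next
    assume local: "\<forall>k\<ge>1. \<exists>c>0. \<forall>m\<ge>1. \<forall>w\<in>tverts G. \<forall>u\<in>desc G k w. \<forall>v\<in>desc G k w. u \<noteq> v \<longrightarrow>
       sup_conductance G P Mstar p m
         \<le> ennreal c * conductance G P p (vheight G w + k) m {u} {v} (desc G k w)"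
    \<comment> \<open>This rate matches the loss 3^p of the three-term splitting.\<close>
    have \<epsilon>: "0 < 1 / 3 powr p" by simp
    obtain k where k: "1 \<le> k" "\<And>l. sup_conductance G P Mstar p (k + l)
        \<le> ennreal (1 / 3 powr p) * sup_conductance G P Mstar p l"
    proof (rule cutoff_exists[OF \<alpha> \<epsilon>])
      fix k :: nat
      assume k: "1 \<le> k" and "\<And>n w. 1 \<le> n \<Longrightarrow> w \<in> level G n \<Longrightarrow> has_cutoff p (1 / 3 powr p) k n w"
      from sup_conductance_decay[OF p \<epsilon> this(2)] show thesis by (rule that[OF k])
    qed
    from local[rule_format, OF k(1)] obtain c where c: "0 < c" "\<forall>m\<ge>1. \<forall>w\<in>tverts G. \<forall>u\<in>desc G k w. \<forall>v\<in>desc G k w. u \<noteq> v \<longrightarrow>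
       sup_conductance G P Mstar p m
         \<le> ennreal c * conductance G P p (vheight G w + k) m {u} {v} (desc G k w)"
      by (elim exE conjE) (rule that)
    show "conductively_homogeneous G P \<mu> Mstar p"
      by (rule local_conductance_imp_homogeneous[OF p k c(1)]) (simp_all add: c(2))
  qed
qed

end
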